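(* Let $n\leq 7$, let $1\le k\le n$, let $\Omega\subset\mathbb{C}^n$ be a domain and let $u\in\mathcal{C}^2(\Omega)$ be real-valued. Then $u$ is $(n-k+1)$-subharmonic in $\Omega$ if and only if $$i\partial\bar\partial u\wedge (i\partial\bar\partial\|z\|^2)^{k-1}\geq 0\quad\text{and}\quad (i\partial\bar\partial u)^{n-k+1}\wedge (i\partial\bar\partial\|z\|^2)^{k-1}\geq 0$$ at every point of $\Omega$.
   Context: For a real-valued $u\in\mathcal{C}^2(\Omega)$ with $\Omega\subset\mathbb{C}^n$, let $\lambda_1(z)\le\dots\le\lambda_n(z)$ be the eigenvalues of the complex Hessian $\left(\frac{\partial^2u}{\partial z_p\partial\bar z_q}(z)\right)_{p,q=1}^n$ and let $\sigma_j(\lambda)=\sum_{1\le i_1<\dots<i_j\le n}\lambda_{i_1}\cdots\lambda_{i_j}$ be the $j$-th elementary symmetric polynomial. A $\mathcal{C}^2$ function $u$ is called $m$-subharmonic ($1\le m\le n$) if $(i\partial\bar\partial u)^j\wedge(i\partial\bar\partial\|z\|^2)^{n-j}\ge 0$ for every $j=1,\dots,m$; equivalently, $\sigma_j(\lambda(z))\ge 0$ for every $j=1,\dots,m$ and every $z\in\Omega$. (An $(n-k+1)$-subharmonic function is also called B-$k$-subharmonic.) The $(k,k)$-form condition $i\partial\bar\partial u\wedge (i\partial\bar\partial\|z\|^2)^{k-1}\geq 0$ (positivity of the form) is equivalent to $\lambda_1(z)+\dots+\lambda_k(z)\ge 0$ for every $z\in\Omega$, i.e. the sum of any $k$ eigenvalues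 is nonnegative (this is called $k$-plurisubharmonicity of $u$). The top-degree condition $(i\partial\bar\partial u)^{n-k+1}\wedge (i\partial\bar\partial\|z\|^2)^{k-1}\geq 0$ is equivalent to $\sigma_{n-k+1}(\lambda(z))\ge 0$ for every $z\in\Omega$. The two conditions together say that $u$ is A-$k$-subharmonic. *)

theory Defs
  imports "HOL-Analysis.Analysis"
begin

definition C2_on :: "'a::real_normed_vector set \<Rightarrow> ('a \<Rightarrow> 'b::real_normed_vector) \<Rightarrow> bool" where
  "C2_on S f \<longleftrightarrow>
     (\<forall>z\<in>S. f differentiable (at z)) \<and>
     (\<forall>v. \<forall>z\<in>S. (\<lambda>x. frechet_derivative f (at x) v) differentiable (at z)) \<and>
     (\<forall>v w. continuous_on S
        (\<lambda>z. frechet_derivative (\<lambda>x. frechet_derivative f (at x) v) (at z) w))"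

text \<open>Wirtinger derivatives: \<open>axis p 1\<close> and \<open>axis p \<i>\<close> are the directions of the real
  coordinates \<open>x\<^sub>p\<close> and \<open>y\<^sub>p\<close>, where \<open>z\<^sub>p = x\<^sub>p + \<i> y\<^sub>p\<close>.\<close>

definition d_z :: "'n::finite \<Rightarrow> (complex ^ 'n \<Rightarrow> complex) \<Rightarrow> complex ^ 'n \<Rightarrow> complex" where
  "d_z p f z =
     (frechet_derivative f (at z) (axis p 1) - \<i> * frechet_derivative f (at z) (axis p \<i>)) / 2"

definition d_zbar :: "'n::finite \<Rightarrow> (complex ^ 'n \<Rightarrow> complex) \<Rightarrow> complex ^ 'n \<Rightarrow> complex" where
  "d_zbar p f z =
     (frechet_derivative f (at z) (axis p 1) + \<i> * frechet_derivative f (at z) (axis p \<i>)) / 2"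

definition complex_hessian :: "(complex ^ 'n::finite \<Rightarrow> real) \<Rightarrow> complex ^ 'n \<Rightarrow> complex ^ 'n ^ 'n" where
  "complex_hessian u z = (\<chi> p q. d_z p (d_zbar q (\<lambda>x. complex_of_real (u x))) z)"

text \<open>An exterior form of degree \<open>d\<close> at a point is a complex-valued, real-multilinear alternating
  function of \<open>d\<close> real tangent vectors. The vectors are passed as a sequence of which only the
  entries \<open>0, \<dots>, d - 1\<close> matter; the degree is not recorded in the type, so \<open>wedge\<close> takes the
  degrees of both factors. A differential form is a function from points to such forms.\<close>

type_synonym 'n form = "(nat \<Rightarrow> complex ^ 'n) \<Rightarrow> complex"

definition wedge :: "nat \<Rightarrow> nat \<Rightarrow> 'n form \<Rightarrow> 'n form \<Rightarrow> 'n form" where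
  "wedge d e \<alpha> \<beta> v =
     (\<Sum>\<pi> | \<pi> permutes {..<d + e}.
        of_int (sign \<pi>) * \<alpha> (\<lambda>i. v (\<pi> i)) * \<beta> (\<lambda>i. v (\<pi> (d + i)))) / (fact d * fact e)"

text \<open>The \<open>j\<close>-th exterior power of a form of degree 2, a form of degree \<open>2 * j\<close>.\<close>

primrec wedge_power :: "'n form \<Rightarrow> nat \<Rightarrow> 'n form" where
  "wedge_power \<omega> 0 = (\<lambda>v. 1)"
| "wedge_power \<omega> (Suc j) = wedge 2 (2 * j) \<omega> (wedge_power \<omega> j)"

definition dz :: "'n::finite \<Rightarrow> 'n form" where
  "dz p v = v 0 $ p"

definition dzbar :: "'n::finite \<Rightarrow> 'n form" where
  "dzbar p v = cnj (v 0 $ p)"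

definition i_ddbar :: "(complex ^ 'n::finite \<Rightarrow> real) \<Rightarrow> complex ^ 'n \<Rightarrow> 'n form" where
  "i_ddbar u z v =
     \<i> * (\<Sum>p\<in>UNIV. \<Sum>q\<in>UNIV. complex_hessian u z $ p $ q * wedge 1 1 (dz p) (dzbar q) v)"

text \<open>Positivity of a \<open>(d,d)\<close>-form: its restriction to every \<open>d\<close>-dimensional complex subspace is a
  nonnegative volume form for the complex orientation, for which
  \<open>(w\<^sub>1, \<i> w\<^sub>1, \<dots>, w\<^sub>d, \<i> w\<^sub>d)\<close> is a positive frame. For \<open>d = n\<close> this says that the form
  is a nonnegative multiple of the Euclidean volume form.\<close>

definition positive_form :: "nat \<Rightarrow> 'n::finite form \<Rightarrow> bool" where
  "positive_form d \<phi> \<longleftrightarrow>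
     (\<forall>w. \<phi> (\<lambda>i. if even i then w (i div 2) else \<i> *s w (i div 2)) \<in> \<real>\<^sub>\<ge>\<^sub>0)"

text \<open>The form \<open>(i \<partial> \<partial>-bar u)\<^sup>j \<and> (i \<partial> \<partial>-bar \<parallel>z\<parallel>\<^sup>2)\<^sup>l\<close> at the point \<open>z\<close>,
  of bidegree \<open>(j + l, j + l)\<close>.\<close>

definition hessian_form ::
    "nat \<Rightarrow> nat \<Rightarrow> (complex ^ 'n::finite \<Rightarrow> real) \<Rightarrow> complex ^ 'n \<Rightarrow> 'n form" where
  "hessian_form j l u z =
     wedge (2 * j) (2 * l) (wedge_power (i_ddbar u z) j)
       (wedge_power (i_ddbar (\<lambda>x. (norm x)\<^sup>2) z) l)"

definition m_subharmonic_on ::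
    "nat \<Rightarrow> (complex ^ 'n) set \<Rightarrow> (complex ^ 'n::finite \<Rightarrow> real) \<Rightarrow> bool" where
  "m_subharmonic_on m \<Omega> u \<longleftrightarrow> C2_on \<Omega> u \<and>
     (\<forall>j\<in>{1..m}. \<forall>z\<in>\<Omega>. positive_form CARD('n) (hessian_form j (CARD('n) - j) u z))"

end

theory Submission
  imports Defs "HOL-Computational_Algebra.Fundamental_Theorem_Algebra"
    "Jordan_Normal_Form.Determinant"
begin

text \<open>
  Everything is pointwise. At a point \<open>z\<close> the complex Hessian of a \<open>C\<^sup>2\<close> function is Hermitian,
  because mixed second derivatives commute (\<open>second_derivative_symmetric\<close>), so a unitary change of
  coordinates turns \<open>i \<partial> \<partial>-bar u\<close> into a real diagonal combination of the elementary forms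
  \<open>i dz\<^sub>p \<and> d z-bar\<^sub>p\<close>, with the eigenvalues \<open>l\<^sub>p\<close> as coefficients, and leaves
  \<open>i \<partial> \<partial>-bar \<parallel>z\<parallel>\<^sup>2\<close> unchanged. On a complex frame \<open>w\<close> a product of \<open>d\<close> elementary forms is
  \<open>2\<^sup>d \<bar>det\<bar>\<^sup>2\<close> of the corresponding \<open>d \<times> d\<close> matrix of coordinates of \<open>w\<close>
  (\<open>alternation_frame\<close>). Hence the values of all forms in question on complex frames are sums of
  products of eigenvalues with nonnegative weights (\<open>hessian_form_frame\<close>), and reading off these
  sums gives \<open>eigenvalue_criteria\<close>: in top degree positivity means that an elementary symmetric
  polynomial \<open>\<sigma>\<^sub>j\<close> of the eigenvalues is nonnegative, and positivity of
  \<open>i \<partial> \<partial>-bar u \<and> (i \<partial> \<partial>-bar \<parallel>z\<parallel>\<^sup>2)\<^sup>k\<^sup>-\<^sup>1\<close> means that all sums of \<open>k\<close> eigenvalues are nonnegative.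

  What remains is a statement on \<open>n \<le> 7\<close> real numbers, with \<open>m = n - k + 1\<close>: the numbers
  \<open>\<sigma>\<^sub>1, \<dots>, \<sigma>\<^sub>m\<close> are all nonnegative iff \<open>\<sigma>\<^sub>m\<close> is and all \<open>k\<close>-element sums are. The numbers
  \<open>\<sigma>\<^sub>j\<close> are the coefficients of the real-rooted polynomial \<open>\<Prod>p. (1 + l\<^sub>p t)\<close>, and so they satisfy
  Newton's inequalities. These show that deleting one entry from a tuple with
  \<open>\<sigma>\<^sub>1, \<dots>, \<sigma>\<^sub>m \<ge> 0\<close> leaves a tuple with \<open>\<sigma>\<^sub>1, \<dots>, \<sigma>\<^sub>m\<^sub>-\<^sub>1 \<ge> 0\<close>
  (\<open>nonneg_coeffs_remove_factor\<close>). Deleting \<open>m - 1\<close> entries leaves \<open>k\<close> entries with a nonnegative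
  sum, which is the forward direction.

  For the converse, let \<open>a\<close> be the smallest entry and \<open>\<mu>\<close> the remaining \<open>n - 1 \<le> 6\<close> entries. If
  \<open>a\<close> is negative, then it suffices to know that \<open>\<sigma>\<^sub>1(\<mu>), \<dots>, \<sigma>\<^sub>m\<^sub>-\<^sub>1(\<mu>)\<close> are nonnegative: by
  Newton's inequalities the ratios \<open>\<sigma>\<^sub>j(\<mu>) / \<sigma>\<^sub>j\<^sub>-\<^sub>1(\<mu>)\<close> decrease in \<open>j\<close>, and \<open>\<sigma>\<^sub>m \<ge> 0\<close> says that the
  last of them is at least \<open>- a\<close>, so all of them are (\<open>nonneg_coeffs_insert_negative\<close>). Since \<open>a\<close> is at
  most the smallest entry of \<open>\<mu>\<close>, the hypothesis on sums gives
  \<open>2 \<mu>\<^sub>1 + \<mu>\<^sub>2 + \<dots> + \<mu>\<^sub>k\<^sub>-\<^sub>1 \<ge> 0\<close> for the sorted entries of \<open>\<mu>\<close>. The sorted tuples with this property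
  form a polyhedral cone. Expanding \<open>\<sigma>\<^sub>j(\<mu>)\<close> in coordinates along the extreme rays of this cone
  gives polynomials with nonnegative coefficients as long as \<open>\<mu>\<close> has at most six entries
  (\<open>nonneg_coeffs_six\<close>). This is where \<open>n \<le> 7\<close> enters, and it leaves no room: for \<open>k = 3\<close> the
  ray \<open>(-1, 2, 2, 2, 2, 2)\<close> has \<open>\<sigma>\<^sub>4 = 0\<close>, and with one more entry \<open>2\<close> it would have \<open>\<sigma>\<^sub>5 < 0\<close>.
\<close>

no_notation vec_index (infixl "$" 100)
no_notation scalar_prod (infix "\<bullet>" 70)

section \<open>Real-rooted polynomials and Newton's inequalities\<close>

abbreviation cpoly :: "real poly \<Rightarrow> complex poly" where
  "cpoly \<equiv> map_poly complex_of_real"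

definition real_rooted :: "real poly \<Rightarrow> bool" where
  "real_rooted p \<longleftrightarrow> (\<forall>z. poly (cpoly p) z = 0 \<longrightarrow> z \<in> \<real>)"

lemma cpoly_mult: "cpoly (p * q) = cpoly p * cpoly q"
  by (intro poly_eqI) (simp add: coeff_map_poly coeff_mult)

lemma cpoly_pderiv: "cpoly (pderiv p) = pderiv (cpoly p)"
  by (intro poly_eqI) (simp add: coeff_map_poly coeff_pderiv)

lemma poly_cpoly_of_real: "poly (cpoly p) (of_real x) = of_real (poly p x)"
  by (induction p) (auto simp: map_poly_pCons)

lemma real_rooted_mult [simp]: "real_rooted (p * q) \<longleftrightarrow> real_rooted p \<and> real_rooted q"
  by (auto simp: real_rooted_def cpoly_mult)

lemma real_rooted_linear: "real_rooted [:1, x:]"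
proof -
  have "z \<in> \<real>" if "1 + z * complex_of_real x = 0" for z
  proof -
    have "x \<noteq> 0" using that by auto
    then have "z = of_real (- 1 / x)" using that by (simp add: field_simps eq_neg_iff_add_eq_0)
    then show ?thesis by (metis Reals_of_real)
  qed
  then show ?thesis by (simp add: real_rooted_def map_poly_pCons)
qed

text \<open>The fundamental theorem of algebra supplies a complex root, which is real by assumption; this
  permits inductions on the degree that stay inside the real polynomials.\<close>

lemma real_rooted_factor:
  assumes "real_rooted p" "degree p > 0"
  obtains r q where "p = [:- r, 1:] * q" "real_rooted q" "degree p = Suc (degree q)"
proof -
  have "degree (cpoly p) = degree p" by (simp add: degree_map_poly)
  then have "\<not> constant (poly (cpoly p))"
    using assms(2) by (simp add: constant_degree)
  then obtain z where z: "poly (cpoly p) z = 0"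
    using fundamental_theorem_of_algebra by blast
  then obtain r where "z = of_real r"
    using assms(1) by (auto simp: real_rooted_def elim: Reals_cases)
  then have "poly p r = 0" using z by (simp add: poly_cpoly_of_real)
  then obtain q where q: "p = [:- r, 1:] * q" by (auto simp: poly_eq_0_iff_dvd elim: dvdE)
  moreover have "q \<noteq> 0" using q assms(2) by auto
  ultimately show ?thesis using assms(1) that[of r q] degree_mult_eq[of "[:- r, 1:]" q]
    by (auto simp del: mult_pCons_left)
qed

text \<open>The Gauss--Lucas argument: \<open>p' / p\<close> is the sum of \<open>1 / (z - r)\<close> over the real roots \<open>r\<close>, and the
  imaginary part of each summand has the sign opposite to that of \<open>Im z\<close>. So \<open>p'\<close> cannot vanish off
  the real axis.\<close>

lemma log_derivative_half_plane:
  assumes "real_rooted p" "degree p > 0" "Im z \<noteq> 0"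
  shows "Im z * Im (poly (pderiv (cpoly p)) z / poly (cpoly p) z) < 0"
  using assms(1,2)
proof (induction "degree p" arbitrary: p)
  case 0
  then show ?case by simp
next
  case (Suc d)
  obtain r q where q: "p = [:- r, 1:] * q" "real_rooted q" "degree p = Suc (degree q)"
    using real_rooted_factor Suc.prems by metis
  define w where "w = z - of_real r"
  have w: "Im w = Im z" "w \<noteq> 0" using assms(3) by (auto simp: w_def)
  have "poly (cpoly q) z \<noteq> 0" if "q \<noteq> 0"
    using q(2) assms(3) by (auto simp: real_rooted_def complex_is_Real_iff)
  moreover have "q \<noteq> 0" using q(1) Suc.prems(2) by auto
  ultimately have nz: "poly (cpoly q) z \<noteq> 0" by blast
  have c: "cpoly p = [:- of_real r, 1:] * cpoly q"
    unfolding q(1) cpoly_mult by (simp add: map_poly_pCons)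
  have eq: "poly (pderiv (cpoly p)) z / poly (cpoly p) z
      = 1 / w + poly (pderiv (cpoly q)) z / poly (cpoly q) z"
    unfolding c pderiv_mult using nz w(2) by (simp add: w_def pderiv_pCons field_simps)
  have 1: "Im z * Im (1 / w) < 0"
    using w assms(3) by (simp add: Im_divide power2_eq_square[symmetric] sum_power2_gt_zero_iff
        divide_pos_pos zero_less_mult_iff divide_neg_pos mult_neg_pos)
  have 2: "Im z * Im (poly (pderiv (cpoly q)) z / poly (cpoly q) z) \<le> 0"
  proof (cases "degree q = 0")
    case True
    then show ?thesis by (auto elim!: degree_eq_zeroE simp: map_poly_pCons pderiv_pCons)
  next
    case False
    then show ?thesis using Suc.hyps(1)[of q] Suc.hyps(2) q by auto
  qed
  show ?case unfolding eq using 1 2 by (simp add: distrib_left)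
qed

lemma real_rooted_pderiv:
  assumes "real_rooted p"
  shows "real_rooted (pderiv p) \<or> pderiv p = 0"
proof (cases "degree p = 0")
  case True
  then show ?thesis by (simp add: pderiv_eq_0_iff)
next
  case False
  have "z \<in> \<real>" if "poly (pderiv (cpoly p)) z = 0" for z
    using log_derivative_half_plane[OF assms, of z] False that by (force simp: complex_is_Real_iff)
  then show ?thesis by (simp add: real_rooted_def cpoly_pderiv)
qed

text \<open>At a point where \<open>p\<close> does not vanish, \<open>p'\<^sup>2 - p p''\<close> is \<open>p\<^sup>2\<close> times the sum of
  \<open>1 / (x - r)\<^sup>2\<close> over the roots \<open>r\<close>. The coefficients of index \<open>0, 1, 2\<close> express this quantity at
  \<open>x = 0\<close>.\<close>

lemma laguerre_inequality:
  assumes "real_rooted p"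
  shows "2 * coeff p 0 * coeff p 2 \<le> (coeff p 1)\<^sup>2
    \<and> (degree p > 0 \<and> coeff p 0 \<noteq> 0 \<longrightarrow> 2 * coeff p 0 * coeff p 2 < (coeff p 1)\<^sup>2)"
  using assms
proof (induction "degree p" arbitrary: p)
  case 0
  then have "coeff p 2 = 0" "coeff p 1 = 0" by (simp_all add: coeff_eq_0)
  then show ?case using 0 by simp
next
  case (Suc d)
  obtain r q where q: "p = [:- r, 1:] * q" "real_rooted q" "degree p = Suc (degree q)"
    using real_rooted_factor Suc by (metis zero_less_Suc)
  define a b c where "a = coeff q 0" and "b = coeff q 1" and "c = coeff q 2"
  have "coeff p 0 = - r * a" "coeff p 1 = a - r * b" "coeff p 2 = b - r * c"
    unfolding q(1) by (simp_all add: a_def b_def c_def coeff_pCons numeral_2_eq_2)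
  then have "(coeff p 1)\<^sup>2 - 2 * coeff p 0 * coeff p 2 = a\<^sup>2 + r\<^sup>2 * (b\<^sup>2 - 2 * a * c)"
    and "coeff p 0 \<noteq> 0 \<longrightarrow> a \<noteq> 0"
    by (auto simp: power2_eq_square algebra_simps)
  moreover have "2 * a * c \<le> b\<^sup>2"
    using Suc.hyps q by (simp add: a_def b_def c_def)
  then have "0 \<le> r\<^sup>2 * (b\<^sup>2 - 2 * a * c)" by simp
  ultimately show ?case
    by (smt (verit) zero_le_power2 zero_less_power2)
qed

lemma real_rooted_higher_pderiv:
  "real_rooted p \<Longrightarrow> real_rooted ((pderiv ^^ m) p) \<or> (pderiv ^^ m) p = 0"
  by (induction m) (auto dest: real_rooted_pderiv)

text \<open>Laguerre's inequality for the \<open>m\<close>-th derivative, which is real-rooted (or zero) again and has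
  multiples of the coefficients \<open>m, m + 1, m + 2\<close> of \<open>p\<close> as its lowest coefficients.\<close>

lemma newton_inequality:
  assumes "real_rooted p"
  shows "real (m + 2) * (coeff p m * coeff p (m + 2)) \<le> real (m + 1) * (coeff p (m + 1))\<^sup>2"
proof -
  define q where "q = (pderiv ^^ m) p"
  have "2 * coeff q 0 * coeff q 2 \<le> (coeff q 1)\<^sup>2"
    using real_rooted_higher_pderiv[OF assms, of m] laguerre_inequality[of q] by (auto simp: q_def)
  moreover have "coeff q 0 = fact m * coeff p m"
    by (simp add: q_def coeff_higher_pderiv pochhammer_fact)
  moreover have "coeff q 1 = fact m * real (m + 1) * coeff p (m + 1)"
    using pochhammer_rec[of "1::real" m]
    by (simp add: q_def coeff_higher_pderiv pochhammer_fact[symmetric] algebra_simps pochhammer_Suc)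
  moreover have "2 * coeff q 2 = fact m * real (m + 1) * real (m + 2) * coeff p (m + 2)"
  proof -
    have "2 * pochhammer (3::real) m = pochhammer 1 (m + 2)"
      using pochhammer_rec[of "1::real" "Suc m"] pochhammer_rec[of "2::real" m] by simp
    also have "\<dots> = fact m * real (m + 1) * real (m + 2)"
      by (simp add: pochhammer_fact[symmetric] algebra_simps)
    finally show ?thesis
      by (simp add: q_def coeff_higher_pderiv add.commute[of 2])
  qed
  moreover have "2 * coeff q 0 * coeff q 2 = coeff q 0 * (2 * coeff q 2)" by simp
  ultimately have "(fact m * coeff p m) * (fact m * real (m + 1) * real (m + 2) * coeff p (m + 2))
      \<le> (fact m * real (m + 1) * coeff p (m + 1))\<^sup>2" by metis
  then have "(fact m)\<^sup>2 * real (m + 1) * (real (m + 2) * (coeff p m * coeff p (m + 2)))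
      \<le> (fact m)\<^sup>2 * real (m + 1) * (real (m + 1) * (coeff p (m + 1))\<^sup>2)"
    by (simp add: power2_eq_square mult_ac)
  then show ?thesis by (subst (asm) mult_le_cancel_left_pos) (simp_all)
qed

text \<open>The equality case: two vanishing coefficients make Laguerre's inequality for the \<open>m\<close>-th derivative
  an equality, and so this derivative has no roots.\<close>

lemma consecutive_zero_coeffs:
  assumes "real_rooted p" "coeff p m \<noteq> 0" "coeff p (m + 1) = 0" "coeff p (m + 2) = 0"
  shows "degree p = m"
proof -
  define q where "q = (pderiv ^^ m) p"
  have nz: "coeff q 0 \<noteq> 0"
    using assms(2) by (simp add: q_def coeff_higher_pderiv pochhammer_fact[symmetric])
  moreover have "coeff q 1 = 0" "coeff q 2 = 0"
    using assms(3,4) by (simp_all add: q_def coeff_higher_pderiv add.commute)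
  ultimately have "degree q = 0"
    using real_rooted_higher_pderiv[OF assms(1), of m] laguerre_inequality[of q] by (auto simp: q_def)
  moreover have "degree q = degree p - m"
    unfolding q_def by (induction m) (simp_all add: degree_pderiv)
  ultimately show ?thesis using le_degree[OF assms(2)] by simp
qed

section \<open>Nonnegativity of elementary symmetric polynomials\<close>

text \<open>For \<open>p = (\<Prod>i. [:1, x\<^sub>i:])\<close> this says that \<open>x\<close> lies in the closed Garding cone \<open>\<Gamma>\<^sub>m\<close>.\<close>

definition nonneg_coeffs :: "nat \<Rightarrow> real poly \<Rightarrow> bool" where
  "nonneg_coeffs m p \<longleftrightarrow> (\<forall>j\<le>m. 0 \<le> coeff p j)"

lemma nonneg_coeffs_mult:
  "nonneg_coeffs m p \<Longrightarrow> nonneg_coeffs m q \<Longrightarrow> nonneg_coeffs m (p * q)"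
  unfolding nonneg_coeffs_def coeff_mult by (auto intro!: sum_nonneg)

text \<open>Let \<open>b\<close> be the first negative coefficient of \<open>p\<close> and \<open>a\<close>, \<open>c\<close> its neighbours. Nonnegativity of two
  consecutive coefficients of the product forces \<open>x a \<ge> - b > 0\<close> and \<open>c \<ge> - x b\<close>, whence
  \<open>a c \<ge> b\<^sup>2 > 0\<close>, which contradicts Newton's inequality.\<close>

lemma nonneg_coeffs_remove_factor:
  assumes p: "real_rooted p" "0 < coeff p 0"
    and nn: "nonneg_coeffs (Suc m) ([:1, x:] * p)"
  shows "nonneg_coeffs m p"
  unfolding nonneg_coeffs_def
proof (intro allI impI)
  fix j assume "j \<le> m"
  then show "0 \<le> coeff p j"
  proof (induction j rule: less_induct)
    case (less j)
    show ?case
    proof (cases j)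
      case 0
      then show ?thesis using p by simp
    next
      case (Suc i)
      define a b c where "a = coeff p i" and "b = coeff p (Suc i)" and "c = coeff p (Suc (Suc i))"
      have "a \<ge> 0" using less Suc by (simp add: a_def)
      have bc: "b + x * a \<ge> 0" "c + x * b \<ge> 0"
        using nn less.prems Suc by (auto simp: nonneg_coeffs_def a_def b_def c_def
            dest: spec[of _ "Suc i"] spec[of _ "Suc (Suc i)"])
      have newt: "real (i + 2) * (a * c) \<le> real (i + 1) * b\<^sup>2"
        using newton_inequality[OF p(1), of i] by (simp add: a_def b_def c_def)
      have "b \<ge> 0"
      proof (rule ccontr)
        assume "\<not> b \<ge> 0"
        then have "b < 0" by simp
        have "b\<^sup>2 \<le> - b * (x * a)"
          using bc(1) \<open>b < 0\<close> mult_left_mono[of "- b" "x * a" "- b"] by (simp add: power2_eq_square)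
        also have "\<dots> = a * (- (x * b))" by simp
        also have "\<dots> \<le> a * c"
          using bc(2) \<open>a \<ge> 0\<close> by (intro mult_left_mono) auto
        finally have "b\<^sup>2 \<le> a * c" .
        moreover have "b\<^sup>2 > 0" using \<open>b < 0\<close> by simp
        ultimately have "real (i + 1) * b\<^sup>2 < real (i + 2) * (a * c)"
          by (intro mult_less_le_imp_less) auto
        then show False using newt by simp
      qed
      then show ?thesis by (simp add: b_def Suc)
    qed
  qed
qed

text \<open>The claim for the coefficient \<open>j + 1\<close> is that the ratio of the coefficients \<open>j + 1\<close> and \<open>j\<close> of \<open>p\<close>
  is at least \<open>- x\<close>. By Newton's inequality these ratios decrease, and the hypothesis on the coefficient
  \<open>m + 1\<close> bounds the last of them. The hypothesis on the degree makes the ratios meaningful: a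
  vanishing coefficient would be followed by another one, and all later ones would vanish.\<close>

lemma nonneg_coeffs_insert_negative:
  assumes p: "real_rooted p" "0 < coeff p 0" "m \<le> degree p"
    and nn: "nonneg_coeffs m p"
    and x: "x < 0" and top: "0 \<le> coeff ([:1, x:] * p) (Suc m)"
  shows "nonneg_coeffs (Suc m) ([:1, x:] * p)"
proof -
  have top': "0 \<le> coeff p (Suc m) + x * coeff p m" using top by simp
  have nn': "0 \<le> coeff p j" if "j \<le> m" for j using nn that by (simp add: nonneg_coeffs_def)
  have pos: "0 < coeff p j" if "j \<le> m" for j
    using that
  proof (induction j)
    case 0
    then show ?case using p by simp
  next
    case (Suc i)
    have "coeff p (Suc i) \<noteq> 0"
    proof
      assume z: "coeff p (Suc i) = 0"
      have "real (i + 2) * (coeff p i * coeff p (i + 2)) \<le> 0"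
        using newton_inequality[OF p(1), of i] z by simp
      then have "coeff p (i + 2) \<le> 0" using Suc
        by (simp add: mult_le_0_iff zero_le_mult_iff not_less[symmetric] del: not_less) (auto simp: mult_less_0_iff not_less mult_le_0_iff)
      moreover have "0 \<le> coeff p (i + 2)"
      proof (cases "Suc i = m")
        case True
        then show ?thesis using top' z by auto
      next
        case False
        then show ?thesis using Suc.prems nn'[of "i + 2"] by simp
      qed
      ultimately have "degree p = i"
        using consecutive_zero_coeffs[OF p(1), of i] z Suc by auto
      then show False using Suc.prems p(3) by simp
    qed
    then show ?case using nn'[OF Suc.prems] by simp
  qed
  \<comment> \<open>Downward induction: Newton's inequality passes the bound on the ratio from \<open>j + 1\<close> to \<open>j\<close>.\<close>
  have "0 \<le> coeff p (Suc j) + x * coeff p j" if "j \<le> m" for j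
    using that
  proof (induction rule: inc_induct)
    case base
    then show ?case using top' .
  next
    case (step j)
    have a: "coeff p j > 0" and b: "coeff p (Suc j) > 0" using pos step by auto
    have "real (j + 2) * (coeff p j * (- x * coeff p (Suc j)))
        \<le> real (j + 2) * (coeff p j * coeff p (j + 2))"
      using step a by (intro mult_left_mono) auto
    also have "\<dots> \<le> real (j + 1) * (coeff p (j + 1))\<^sup>2" by (rule newton_inequality[OF p(1)])
    also have "\<dots> \<le> real (j + 2) * (coeff p (j + 1))\<^sup>2" by (intro mult_right_mono) auto
    finally have "(- x * coeff p j) * coeff p (Suc j) \<le> coeff p (Suc j) * coeff p (Suc j)"
      by (subst (asm) mult_le_cancel_left_pos) (simp_all add: power2_eq_square mult_ac)
    then show ?case using b by (subst (asm) mult_le_cancel_right_pos) simp_all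
  qed
  moreover have "coeff ([:1, x:] * p) j
      = (case j of 0 \<Rightarrow> coeff p 0 | Suc i \<Rightarrow> coeff p (Suc i) + x * coeff p i)" for j
    by (simp split: nat.split)
  ultimately show ?thesis using p(2) by (auto simp: nonneg_coeffs_def split: nat.split)
qed

definition esym_poly :: "real list \<Rightarrow> real poly" where
  "esym_poly xs = (\<Prod>x\<leftarrow>xs. [:1, x:])"

lemma esym_poly_simps [simp]:
  "esym_poly [] = 1" "esym_poly (x # xs) = [:1, x:] * esym_poly xs"
  by (simp_all add: esym_poly_def)

lemma real_rooted_esym_poly: "real_rooted (esym_poly xs)"
  by (induction xs) (use real_rooted_linear real_rooted_linear[of 0] in \<open>auto simp del: mult_pCons_left simp flip: one_pCons\<close>)

lemma coeff_0_esym_poly [simp]: "coeff (esym_poly xs) 0 = 1"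
  by (induction xs) auto

lemma nonneg_coeffs_esym_poly: "(\<And>x. x \<in> set xs \<Longrightarrow> 0 \<le> x) \<Longrightarrow> nonneg_coeffs m (esym_poly xs)"
proof (induction xs)
  case Nil
  then show ?case by (simp add: nonneg_coeffs_def)
next
  case (Cons x xs)
  then have "nonneg_coeffs m [:1, x:]" by (auto simp: nonneg_coeffs_def coeff_pCons split: nat.split)
  then show ?case using Cons by (simp del: mult_pCons_left add: nonneg_coeffs_mult)
qed

lemma nonneg_coeffs_numeral:
  "nonneg_coeffs 2 p \<longleftrightarrow> 0 \<le> coeff p 0 \<and> 0 \<le> coeff p 1 \<and> 0 \<le> coeff p 2"
  "nonneg_coeffs 3 p \<longleftrightarrow> nonneg_coeffs 2 p \<and> 0 \<le> coeff p 3"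
  "nonneg_coeffs 4 p \<longleftrightarrow> nonneg_coeffs 3 p \<and> 0 \<le> coeff p 4"
  by (auto simp: nonneg_coeffs_def le_Suc_eq numeral_eq_Suc)


text \<open>The ray \<open>(-1, 2, 2, 2, 2, 2)\<close>, the ray \<open>(1, 1, 1, 1, 1, 1)\<close> and unit vectors for the entries beyond
  the second; the latter generate more than the sorted tuples and keep the expansion short. The
  coefficient of \<open>b\<^sup>4\<close> in the fourth elementary symmetric polynomial is \<open>80 - 80 = 0\<close>.\<close>

lemma nonneg_coeffs_cone_3:
  fixes b e c3 c4 c5 c6 :: real
  assumes "0 \<le> b" "0 \<le> e" "0 \<le> c3" "0 \<le> c4" "0 \<le> c5" "0 \<le> c6"
  shows "nonneg_coeffs 4 (esym_poly [e - b, e + 2 * b, e + 2 * b + c3, e + 2 * b + c4, e + 2 * b + c5, e + 2 * b + c6])"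
  unfolding nonneg_coeffs_numeral
  by (intro conjI; simp add: numeral_eq_Suc coeff_pCons; simp add: algebra_simps;
      intro add_nonneg_nonneg mult_nonneg_nonneg; use assms in simp)

text \<open>Here the rays are \<open>(-1, 1, 1, 1, 1, 1)\<close> and \<open>(-1, -1, 3, 3, 3, 3)\<close>; the first one has a vanishing
  third elementary symmetric polynomial.\<close>

lemma nonneg_coeffs_cone_4:
  fixes a b e c4 c5 c6 :: real
  assumes "0 \<le> a" "0 \<le> b" "0 \<le> e" "0 \<le> c4" "0 \<le> c5" "0 \<le> c6"
  shows "nonneg_coeffs 3 (esym_poly [e - a - b, e + a - b, e + a + 3 * b,
    e + a + 3 * b + c4, e + a + 3 * b + c5, e + a + 3 * b + c6])"
  unfolding nonneg_coeffs_numeral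
  by (intro conjI; simp add: numeral_eq_Suc coeff_pCons; simp add: algebra_simps;
      (intro add_nonneg_nonneg mult_nonneg_nonneg)?; use assms in simp)

text \<open>Here the rays are \<open>(-3, 2, 2, 2, 2, 2)\<close>, \<open>(-2, -2, 3, 3, 3, 3)\<close> and \<open>(-1, -1, -1, 4, 4, 4)\<close>.\<close>

lemma nonneg_coeffs_cone_5:
  fixes a b c e c5 c6 :: real
  assumes "0 \<le> a" "0 \<le> b" "0 \<le> c" "0 \<le> e" "0 \<le> c5" "0 \<le> c6"
  shows "nonneg_coeffs 2 (esym_poly [e - 3 * a - 2 * b - c, e + 2 * a - 2 * b - c, e + 2 * a + 3 * b - c,
    e + 2 * a + 3 * b + 4 * c, e + 2 * a + 3 * b + 4 * c + c5, e + 2 * a + 3 * b + 4 * c + c6])"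
  unfolding nonneg_coeffs_numeral
  by (intro conjI; simp add: numeral_eq_Suc coeff_pCons; simp add: algebra_simps;
      (intro add_nonneg_nonneg mult_nonneg_nonneg)?; use assms in simp)

text \<open>For \<open>k = 3, 4, 5\<close> the coordinates along the rays are, up to positive factors, differences of
  entries and the sum that is assumed to be nonnegative. For \<open>k = 2\<close> all entries are
  nonnegative, and for \<open>k = 6\<close> only the sum of the entries matters.\<close>

lemma nonneg_coeffs_six:
  assumes len: "length ys = 6" and "sorted ys" and k: "2 \<le> k" "k \<le> 7"
    and sum: "0 \<le> ys ! 0 + sum_list (take (k - 1) ys)"
  shows "nonneg_coeffs (7 - k) (esym_poly ys)"
proof -
  obtain a1 a2 a3 a4 a5 a6 where ys: "ys = [a1, a2, a3, a4, a5, a6]"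
    using len by (auto simp: numeral_eq_Suc length_Suc_conv)
  have ord: "a1 \<le> a2" "a2 \<le> a3" "a3 \<le> a4" "a4 \<le> a5" "a5 \<le> a6" using \<open>sorted ys\<close> by (auto simp: ys)
  from k consider "k = 2" | "k = 3" | "k = 4" | "k = 5" | "k = 6" | "k = 7" by linarith
  then show ?thesis
  proof cases
    case 1
    then show ?thesis using sum ord by (intro nonneg_coeffs_esym_poly) (auto simp: ys)
  next
    case 2
    have "nonneg_coeffs 4 (esym_poly [(2*a1+a2)/3 - (a2-a1)/3, (2*a1+a2)/3 + 2*((a2-a1)/3),
        (2*a1+a2)/3 + 2*((a2-a1)/3) + (a3-a2), (2*a1+a2)/3 + 2*((a2-a1)/3) + (a4-a2),
        (2*a1+a2)/3 + 2*((a2-a1)/3) + (a5-a2), (2*a1+a2)/3 + 2*((a2-a1)/3) + (a6-a2)])"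
      by (rule nonneg_coeffs_cone_3) (use sum ord 2 in \<open>auto simp: ys numeral_eq_Suc\<close>)
    moreover have "(2*a1+a2)/3 - (a2-a1)/3 = a1" "(2*a1+a2)/3 + 2*((a2-a1)/3) = a2"
      by (simp_all add: field_simps)
    ultimately show ?thesis by (simp only: ys 2) simp
  next
    case 3
    let ?a = "(a2-a1)/2" and ?b = "(a3-a2)/4" and ?e = "(2*a1+a2+a3)/4"
    have "nonneg_coeffs 3 (esym_poly [?e - ?a - ?b, ?e + ?a - ?b, ?e + ?a + 3 * ?b,
      ?e + ?a + 3 * ?b + (a4-a3), ?e + ?a + 3 * ?b + (a5-a3), ?e + ?a + 3 * ?b + (a6-a3)])"
      by (rule nonneg_coeffs_cone_4) (use sum ord 3 in \<open>auto simp: ys numeral_eq_Suc\<close>)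
    moreover have "?e - ?a - ?b = a1" "?e + ?a - ?b = a2" "?e + ?a + 3 * ?b = a3"
      by (simp_all add: field_simps)
    ultimately show ?thesis by (simp only: ys 3) simp
  next
    case 4
    let ?a = "(a2-a1)/5" and ?b = "(a3-a2)/5" and ?c = "(a4-a3)/5" and ?e = "(2*a1+a2+a3+a4)/5"
    have "nonneg_coeffs 2 (esym_poly [?e - 3 * ?a - 2 * ?b - ?c, ?e + 2 * ?a - 2 * ?b - ?c,
      ?e + 2 * ?a + 3 * ?b - ?c, ?e + 2 * ?a + 3 * ?b + 4 * ?c,
      ?e + 2 * ?a + 3 * ?b + 4 * ?c + (a5-a4), ?e + 2 * ?a + 3 * ?b + 4 * ?c + (a6-a4)])"
      by (rule nonneg_coeffs_cone_5) (use sum ord 4 in \<open>auto simp: ys numeral_eq_Suc\<close>)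
    moreover have "?e - 3 * ?a - 2 * ?b - ?c = a1" "?e + 2 * ?a - 2 * ?b - ?c = a2"
      "?e + 2 * ?a + 3 * ?b - ?c = a3" "?e + 2 * ?a + 3 * ?b + 4 * ?c = a4"
      by (simp_all add: field_simps)
    ultimately show ?thesis by (simp only: ys 4) simp
  next
    case 5
    have "0 \<le> a1 + a2 + a3 + a4 + a5 + a6" using sum ord 5 by (auto simp: ys numeral_eq_Suc)
    then show ?thesis using 5 by (auto simp: nonneg_coeffs_def ys le_Suc_eq numeral_eq_Suc)
  next
    case 6
    then show ?thesis by (simp add: nonneg_coeffs_def)
  qed
qed

lemma nonneg_coeffs_esym_poly_append:
  "nonneg_coeffs (m + length zs) (esym_poly (zs @ xs)) \<Longrightarrow> nonneg_coeffs m (esym_poly xs)"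
proof (induction zs)
  case (Cons z zs)
  then show ?case using nonneg_coeffs_remove_factor[OF real_rooted_esym_poly, of "zs @ xs" "m + length zs" z]
    by (simp del: mult_pCons_left)
qed auto

lemma esym_poly_append: "esym_poly (xs @ ys) = esym_poly xs * esym_poly ys"
  by (induction xs) (simp_all del: mult_pCons_left add: mult.assoc)

text \<open>Repeating the largest entry until there are six entries does not affect the hypothesis, and it
  raises the number of entries and the index of the last coefficient in the conclusion by the same amount.
  Deleting the repeated entries again lowers that index by one for each of them.\<close>

lemma nonneg_coeffs_at_most_six:
  assumes len: "length xs \<le> 6" and "sorted xs" and k: "2 \<le> k" "k \<le> Suc (length xs)"
    and sum: "0 \<le> xs ! 0 + sum_list (take (k - 1) xs)"
  shows "nonneg_coeffs (Suc (length xs) - k) (esym_poly xs)"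
proof -
  define r where "r = 6 - length xs"
  define zs where "zs = replicate r (last xs)"
  have ne: "xs \<noteq> []" using k by auto
  then have le: "x \<le> last xs" if "x \<in> set xs" for x
    using \<open>sorted xs\<close> that
    by (metis append_butlast_last_id append_Nil2 list.set_intros(1) sorted_append in_set_conv_decomp
      last_ConsL UnE set_append empty_iff insert_iff list.set(1) list.set(2) order_refl)
  have "nonneg_coeffs (7 - k) (esym_poly (xs @ zs))"
  proof (rule nonneg_coeffs_six)
    show "length (xs @ zs) = 6" using len by (simp add: zs_def r_def)
    show "sorted (xs @ zs)" using \<open>sorted xs\<close> le by (auto simp: sorted_append zs_def)
    have "(xs @ zs) ! 0 = xs ! 0" using ne by (simp add: nth_append)
    moreover have "take (k - 1) (xs @ zs) = take (k - 1) xs" using k by simp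
    ultimately show "0 \<le> (xs @ zs) ! 0 + sum_list (take (k - 1) (xs @ zs))" using sum by metis
  qed (use k len in auto)
  moreover have "7 - k = (Suc (length xs) - k) + length zs"
    using k len by (auto simp: zs_def r_def)
  ultimately show ?thesis
    using nonneg_coeffs_esym_poly_append[of "Suc (length xs) - k" zs xs]
    by (simp add: esym_poly_append mult.commute)
qed

lemma esym_poly_enum: "distinct ids \<Longrightarrow> esym_poly (map l ids) = (\<Prod>p\<in>set ids. [:1, l p:])"
  by (simp add: esym_poly_def prod.distinct_set_conv_list o_def)

text \<open>Only the order of the values matters below, but the sums of \<open>k\<close> values refer to index sets; so it is
  the indices that are enumerated.\<close>

lemma exists_sorted_enum:
  fixes l :: "'i \<Rightarrow> real"
  assumes "finite I" obtains ids where "distinct ids" "set ids = I" "sorted (map l ids)"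
proof -
  obtain xs where "set xs = I" "distinct xs" using finite_distinct_list[OF assms] by blast
  then show ?thesis using that[of "sort_key l xs"] by simp
qed

lemma degree_esym_poly: "degree (esym_poly xs) = length (filter (\<lambda>x. x \<noteq> 0) xs)"
proof (induction xs)
  case (Cons x xs)
  have "esym_poly xs \<noteq> 0" using coeff_0_esym_poly[of xs] by (metis coeff_0 zero_neq_one)
  then show ?case using Cons by (simp del: mult_pCons_left add: degree_mult_eq)
qed auto

lemma coeff_1_esym_poly: "coeff (esym_poly xs) 1 = sum_list xs"
  by (induction xs) auto

text \<open>Deleting the \<open>m - 1\<close> entries outside \<open>S\<close> leaves the condition on the coefficient of index \<open>1\<close>,
  which is the sum over \<open>S\<close>.\<close>

lemma subset_sums_nonneg:
  assumes I: "finite I" and nn: "nonneg_coeffs m (\<Prod>p\<in>I. [:1, l p:])"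
    and S: "S \<subseteq> I" "card S + m = card I + 1" "1 \<le> m"
  shows "0 \<le> sum l S"
proof -
  have fin: "finite S" "finite (I - S)" using I S finite_subset by auto
  obtain xs where xs: "distinct xs" "set xs = S" using finite_distinct_list[OF fin(1)] by blast
  obtain zs where zs: "distinct zs" "set zs = I - S" using finite_distinct_list[OF fin(2)] by blast
  have "length zs = card I - card S" using zs fin S by (metis card_Diff_subset distinct_card)
  then have "1 + length (map l zs) = m" using S card_mono[OF I S(1)] by simp
  moreover have "distinct (zs @ xs)" "set (zs @ xs) = I" using xs zs S by auto
  then have "esym_poly (map l zs @ map l xs) = (\<Prod>p\<in>I. [:1, l p:])"
    using esym_poly_enum[of "zs @ xs" l] by simp
  ultimately have "nonneg_coeffs 1 (esym_poly (map l xs))"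
    using nn nonneg_coeffs_esym_poly_append by metis
  then have "0 \<le> coeff (esym_poly (map l xs)) 1" by (simp add: nonneg_coeffs_def)
  then show ?thesis unfolding coeff_1_esym_poly using xs by (metis sum.distinct_set_conv_list)
qed

text \<open>This is the only place where the bound \<open>7\<close> is needed. The smallest entry is split off; if it is
  negative, the other entries satisfy the hypothesis of \<open>nonneg_coeffs_at_most_six\<close>, and the negative
  entry can be put back because the coefficient of the highest index is known to be nonnegative.\<close>

lemma nonneg_coeffs_of_subset_sums:
  fixes l :: "'i \<Rightarrow> real"
  assumes I: "finite I" "card I \<le> 7" and k: "1 \<le> k" "k \<le> card I"
    and sums: "\<And>S. S \<subseteq> I \<Longrightarrow> card S = k \<Longrightarrow> 0 \<le> sum l S"
    and top: "0 \<le> coeff (\<Prod>p\<in>I. [:1, l p:]) (card I - k + 1)"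
  shows "nonneg_coeffs (card I - k + 1) (\<Prod>p\<in>I. [:1, l p:])"
proof -
  obtain ids where ids: "distinct ids" "set ids = I" "sorted (map l ids)"
    using exists_sorted_enum[OF I(1)] by blast
  have len: "length ids = card I" using ids distinct_card by metis
  then obtain a js where a: "ids = a # js" using k by (cases ids) auto
  define xs where "xs = map l js"
  have P: "(\<Prod>p\<in>I. [:1, l p:]) = [:1, l a:] * esym_poly xs"
    using esym_poly_enum[OF ids(1), of l] ids(2) by (simp add: a xs_def del: mult_pCons_left)
  have mn: "l a \<le> x" if "x \<in> set xs" for x using ids(3) that by (auto simp: a xs_def)
  show ?thesis
  proof (cases "0 \<le> l a")
    case True
    then have "nonneg_coeffs (card I - k + 1) (esym_poly (l a # xs))"
      using mn by (intro nonneg_coeffs_esym_poly) force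
    then show ?thesis unfolding P by (simp del: mult_pCons_left)
  next
    case False
    have leni: "card I = Suc (length xs)" using len by (simp add: a xs_def)
    have take_sum: "0 \<le> l a + sum_list (map l ts)" if "set ts \<subseteq> set js" "distinct ts" "Suc (length ts) = k" for ts
    proof -
      have "a \<notin> set ts" using that ids(1) a by auto
      then have "0 \<le> sum l (insert a (set ts))"
        using that ids a by (intro sums) (auto simp: distinct_card)
      then show ?thesis using \<open>a \<notin> set ts\<close> that by (simp add: sum.distinct_set_conv_list)
    qed
    have "k \<noteq> 1" using take_sum[of "[]"] False by auto
    then have k2: "2 \<le> k" using k by simp
    have "0 \<le> l a + sum_list (map l (take (k - 1) js))"
      using ids k leni by (intro take_sum) (auto simp: a xs_def dest: in_set_takeD)
    moreover have "l a \<le> xs ! 0" using k2 k leni by (intro mn nth_mem) (cases xs; simp)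
    ultimately have "0 \<le> xs ! 0 + sum_list (take (k - 1) xs)" by (simp add: xs_def take_map)
    then have nn: "nonneg_coeffs (card I - k) (esym_poly xs)"
      using nonneg_coeffs_at_most_six[of xs k] ids(3) I(2) k k2 by (simp add: leni xs_def a)
    \<comment> \<open>Otherwise at least \<open>k\<close> of the other entries vanish, and \<open>k - 1\<close> of them together with the
      negative entry have a negative sum.\<close>
    have "card I - k \<le> degree (esym_poly xs)"
    proof (rule ccontr)
      assume "\<not> card I - k \<le> degree (esym_poly xs)"
      moreover have "length (filter (\<lambda>x. x \<noteq> 0) xs) + length (filter (\<lambda>x. x = 0) xs) = length xs"
        using sum_length_filter_compl[of "\<lambda>x. x \<noteq> 0" xs] by simp
      ultimately have z: "k \<le> length (filter (\<lambda>x. x = 0) xs)"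
        using leni k unfolding degree_esym_poly by linarith
      define ts where "ts = take (k - 1) (filter (\<lambda>p. l p = 0) js)"
      have ts: "set ts \<subseteq> {p \<in> set js. l p = 0}" by (auto simp: ts_def dest: in_set_takeD)
      have "length (filter (\<lambda>p. l p = 0) js) \<ge> k" using z by (simp add: xs_def filter_map o_def)
      then have "0 \<le> l a + sum_list (map l ts)"
        using ts ids(1) k by (intro take_sum) (auto simp: ts_def a)
      moreover have "map l ts = replicate (length ts) 0"
        using ts by (intro replicate_eqI) auto
      then have "sum_list (map l ts) = 0" by (simp add: sum_list_replicate)
      ultimately show False using False by simp
    qed
    then show ?thesis
      using nonneg_coeffs_insert_negative[OF real_rooted_esym_poly, of xs "card I - k" "l a"] nn False top
      unfolding P by (simp del: mult_pCons_left coeff_pCons_Suc)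
  qed
qed

section \<open>Exterior products as alternations\<close>

text \<open>Without the factor \<open>1 / d!\<close>: this is the normalization that turns wedge products into alternations
  of tensor products, with no constants left (\<open>wedge_alternation\<close>).\<close>

definition alternation :: "nat \<Rightarrow> 'n form \<Rightarrow> 'n form" where
  "alternation d f v = (\<Sum>\<pi> | \<pi> permutes {..<d}. of_int (sign \<pi>) * f (\<lambda>i. v (\<pi> i)))"

text \<open>Forms are functions of infinite sequences of vectors, and \<open>wedge\<close> passes shifted and permuted
  sequences whose tails differ.\<close>

definition depends_on_first :: "nat \<Rightarrow> 'n form \<Rightarrow> bool" where
  "depends_on_first d f \<longleftrightarrow> (\<forall>v w. (\<forall>i<d. v i = w i) \<longrightarrow> f v = f w)"

lemma block_permutation:
  fixes d e :: nat
  assumes \<rho>: "\<rho> permutes {..<d}" and \<tau>: "\<tau> permutes {..<e}"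
  obtains \<kappa> where "\<kappa> permutes {..<d + e}" "sign \<kappa> = sign \<rho> * sign \<tau>"
    "\<And>i. i < d \<Longrightarrow> \<kappa> i = \<rho> i" "\<And>i. i < e \<Longrightarrow> \<kappa> (d + i) = d + \<tau> i"
proof -
  define \<tau>' where "\<tau>' = map_permutation {..<e} ((+) d) \<tau>"
  have b: "bij_betw ((+) d) {..<e} {d..<d + e}"
    by (rule bij_betw_byWitness[where f' = "\<lambda>i. i - d"]) auto
  have \<tau>': "\<tau>' permutes {d..<d + e}" "sign \<tau>' = sign \<tau>"
    unfolding \<tau>'_def using \<tau> by (auto intro!: map_permutation_permutes[OF b] sign_map_permutation)
  have ap: "\<tau>' (d + i) = d + \<tau> i" if "i < e" for i
    unfolding \<tau>'_def using \<tau> that by (intro map_permutation_apply) auto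
  have p: "\<rho> permutes {..<d + e}" "\<tau>' permutes {..<d + e}"
    using \<rho> \<tau>'(1) by (auto intro: permutes_subset)
  show ?thesis
  proof (rule that[of "\<rho> \<circ> \<tau>'"])
    show "\<rho> \<circ> \<tau>' permutes {..<d + e}" using p by (rule permutes_compose[rotated])
    show "sign (\<rho> \<circ> \<tau>') = sign \<rho> * sign \<tau>"
      using p \<tau>'(2) by (subst sign_compose) (auto intro: permutes_imp_permutation[rotated])
    show "(\<rho> \<circ> \<tau>') i = \<rho> i" if "i < d" for i
      using permutes_not_in[OF \<tau>'(1), of i] that by simp
    show "(\<rho> \<circ> \<tau>') (d + i) = d + \<tau> i" if "i < e" for i
      using permutes_not_in[OF \<rho>, of "d + \<tau> i"] ap[OF that] by simp
  qed
qed

lemma card_permutations_lessThan: "card {\<pi>. \<pi> permutes {..<d::nat}} = fact d"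
  by (subst card_permutations[of _ d]) auto

text \<open>Each pair of inner permutations can be absorbed into the outer one, at the cost of its sign; the number
  \<open>d! e!\<close> of pairs cancels the denominator in the definition of \<open>wedge\<close>.\<close>

lemma wedge_alternation:
  fixes f g :: "'n form"
  assumes f: "depends_on_first d f" and g: "depends_on_first e g"
  shows "wedge d e (alternation d f) (alternation e g)
    = alternation (d + e) (\<lambda>v. f v * g (\<lambda>i. v (d + i)))"
proof
  fix v
  let ?P = "\<lambda>d. {\<pi>. \<pi> permutes {..<d::nat}}"
  define h where "h \<pi> = of_int (sign \<pi>) * (f (\<lambda>i. v (\<pi> i)) * g (\<lambda>i. v (\<pi> (d + i))))" for \<pi>
  have inner: "(\<Sum>\<pi>\<in>?P (d + e). of_int (sign \<pi>) * (of_int (sign \<rho>) * f (\<lambda>i. v (\<pi> (\<rho> i)))) *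
      (of_int (sign \<tau>) * g (\<lambda>i. v (\<pi> (d + \<tau> i))))) = sum h (?P (d + e))"
    if \<rho>: "\<rho> \<in> ?P d" and \<tau>: "\<tau> \<in> ?P e" for \<rho> \<tau>
  proof -
    obtain \<kappa> where \<kappa>: "\<kappa> permutes {..<d + e}" "sign \<kappa> = sign \<rho> * sign \<tau>"
      "\<And>i. i < d \<Longrightarrow> \<kappa> i = \<rho> i" "\<And>i. i < e \<Longrightarrow> \<kappa> (d + i) = d + \<tau> i"
      using block_permutation[of \<rho> d \<tau> e] \<rho> \<tau> by blast
    have "sum h (?P (d + e)) = (\<Sum>\<pi>\<in>?P (d + e). h (\<pi> \<circ> \<kappa>))"
      by (rule sum_permutations_compose_right[OF \<kappa>(1)])
    also have "\<dots> = (\<Sum>\<pi>\<in>?P (d + e). of_int (sign \<pi>) * (of_int (sign \<rho>) * f (\<lambda>i. v (\<pi> (\<rho> i)))) *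
      (of_int (sign \<tau>) * g (\<lambda>i. v (\<pi> (d + \<tau> i)))))"
    proof (rule sum.cong[OF refl])
      fix \<pi> assume \<pi>: "\<pi> \<in> ?P (d + e)"
      have "sign (\<pi> \<circ> \<kappa>) = sign \<pi> * (sign \<rho> * sign \<tau>)"
        using \<pi> \<kappa>(1,2) by (subst sign_compose) (auto intro: permutes_imp_permutation[rotated])
      moreover have "f (\<lambda>i. v ((\<pi> \<circ> \<kappa>) i)) = f (\<lambda>i. v (\<pi> (\<rho> i)))"
        by (rule f[unfolded depends_on_first_def, rule_format]) (simp add: \<kappa>(3))
      moreover have "g (\<lambda>i. v ((\<pi> \<circ> \<kappa>) (d + i))) = g (\<lambda>i. v (\<pi> (d + \<tau> i)))"
        by (rule g[unfolded depends_on_first_def, rule_format]) (simp add: \<kappa>(4))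
      ultimately show "h (\<pi> \<circ> \<kappa>) = of_int (sign \<pi>) * (of_int (sign \<rho>) * f (\<lambda>i. v (\<pi> (\<rho> i)))) *
          (of_int (sign \<tau>) * g (\<lambda>i. v (\<pi> (d + \<tau> i))))"
        unfolding h_def by simp
    qed
    finally show ?thesis by simp
  qed
  have "(\<Sum>\<pi>\<in>?P (d + e). of_int (sign \<pi>) * alternation d f (\<lambda>i. v (\<pi> i)) * alternation e g (\<lambda>i. v (\<pi> (d + i))))
    = (\<Sum>\<pi>\<in>?P (d + e). \<Sum>\<rho>\<in>?P d. \<Sum>\<tau>\<in>?P e. of_int (sign \<pi>) * (of_int (sign \<rho>) * f (\<lambda>i. v (\<pi> (\<rho> i)))) *
      (of_int (sign \<tau>) * g (\<lambda>i. v (\<pi> (d + \<tau> i)))))"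
    unfolding alternation_def sum_distrib_left sum_distrib_right
    by (simp add: mult.assoc, intro sum.cong[OF refl], rule sum.swap)
  also have "\<dots> = (\<Sum>\<rho>\<in>?P d. \<Sum>\<tau>\<in>?P e. \<Sum>\<pi>\<in>?P (d + e). of_int (sign \<pi>) * (of_int (sign \<rho>) * f (\<lambda>i. v (\<pi> (\<rho> i)))) *
      (of_int (sign \<tau>) * g (\<lambda>i. v (\<pi> (d + \<tau> i)))))"
    by (subst sum.swap, rule sum.cong[OF refl], rule sum.swap)
  also have "\<dots> = (\<Sum>\<rho>\<in>?P d. \<Sum>\<tau>\<in>?P e. sum h (?P (d + e)))"
    by (intro sum.cong[OF refl] inner)
  also have "\<dots> = fact d * fact e * sum h (?P (d + e))"
    by (simp add: card_permutations_lessThan)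
  finally show "wedge d e (alternation d f) (alternation e g) v
      = alternation (d + e) (\<lambda>v. f v * g (\<lambda>i. v (d + i))) v"
    unfolding wedge_def alternation_def[of "d + e"] h_def by simp
qed

lemma alternation_1:
  assumes "depends_on_first 1 f" shows "alternation 1 f = f"
proof
  fix v
  have "{\<pi>. \<pi> permutes {..<1::nat}} = {id}" by (simp add: lessThan_Suc)
  then show "alternation 1 f v = f v" by (simp add: alternation_def)
qed

lemma alternation_sum: "alternation d (\<lambda>v. \<Sum>x\<in>X. f x v) v = (\<Sum>x\<in>X. alternation d (f x) v)"
  unfolding alternation_def sum_distrib_left by (rule sum.swap)

lemma alternation_cmult: "alternation d (\<lambda>v. c * f v) v = c * alternation d f v"
  unfolding alternation_def sum_distrib_left by (simp add: mult_ac)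

lemma wedge_power_alternation:
  fixes h :: "complex ^ 'n \<Rightarrow> complex ^ 'n \<Rightarrow> complex"
  assumes "\<omega> = alternation 2 (\<lambda>v. h (v 0) (v 1))"
  shows "wedge_power \<omega> j = alternation (2 * j) (\<lambda>v. \<Prod>i<j. h (v (2 * i)) (v (2 * i + 1)))"
proof (induction j)
  case 0
  have "{\<pi>. \<pi> permutes {}} = {id :: nat \<Rightarrow> nat}" by auto
  then show ?case by (simp add: alternation_def fun_eq_iff)
next
  case (Suc j)
  have "wedge_power \<omega> (Suc j) = alternation (2 + 2 * j) (\<lambda>v. h (v 0) (v 1) *
      (\<Prod>i<j. h (v (2 + 2 * i)) (v (2 + (2 * i + 1)))))"
    unfolding wedge_power.simps Suc.IH unfolding assms
    by (subst wedge_alternation) (auto simp: depends_on_first_def intro!: prod.cong)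
  then show ?case unfolding prod.lessThan_Suc_shift by simp
qed

lemma wedge_powers_alternation:
  fixes h g :: "complex ^ 'n \<Rightarrow> complex ^ 'n \<Rightarrow> complex"
  assumes "\<alpha> = alternation 2 (\<lambda>v. h (v 0) (v 1))" "\<beta> = alternation 2 (\<lambda>v. g (v 0) (v 1))"
  shows "wedge (2 * j) (2 * l) (wedge_power \<alpha> j) (wedge_power \<beta> l)
    = alternation (2 * (j + l)) (\<lambda>v. \<Prod>i<j + l. (if i < j then h else g) (v (2 * i)) (v (2 * i + 1)))"
proof -
  have split: "(\<Prod>i<j + l. F i) = (\<Prod>i<j. F i) * (\<Prod>i<l. F (j + i))" for F :: "nat \<Rightarrow> complex"
    using prod.atLeastLessThan_concat[of 0 j "j + l" F] prod.shift_bounds_nat_ivl[of F 0 j l]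
    by (simp add: lessThan_atLeast0 add.commute)
  have "wedge (2 * j) (2 * l) (wedge_power \<alpha> j) (wedge_power \<beta> l)
    = alternation (2 * j + 2 * l) (\<lambda>v. (\<Prod>i<j. h (v (2 * i)) (v (2 * i + 1))) *
        (\<Prod>i<l. g (v (2 * j + 2 * i)) (v (2 * j + (2 * i + 1)))))"
    unfolding wedge_power_alternation[OF assms(1)] wedge_power_alternation[OF assms(2)]
    by (rule wedge_alternation) (auto simp: depends_on_first_def intro!: prod.cong)
  then show ?thesis by (simp add: split distrib_left add.assoc)
qed

section \<open>A determinant on complex frames\<close>

text \<open>Permuting \<open>{..<d}\<close>, as in \<open>alternation\<close>, and with arbitrary infinite arrays as arguments, so that the
  size of the determinant can be a variable.\<close>

definition leibniz_det :: "nat \<Rightarrow> (nat \<Rightarrow> nat \<Rightarrow> complex) \<Rightarrow> complex" where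
  "leibniz_det d X = (\<Sum>\<sigma> | \<sigma> permutes {..<d}. of_int (sign \<sigma>) * (\<Prod>i<d. X i (\<sigma> i)))"

abbreviation mat_of :: "nat \<Rightarrow> (nat \<Rightarrow> nat \<Rightarrow> complex) \<Rightarrow> complex mat" where
  "mat_of d X \<equiv> mat d d (\<lambda>(i, j). X i j)"

lemma leibniz_det_eq_det: "leibniz_det d X = Determinant.det (mat_of d X)"
  unfolding leibniz_det_def det_def'[OF mat_carrier] atLeast0LessThan
proof (intro sum.cong[OF refl] arg_cong2[where f = "(*)"] prod.cong[OF refl])
  fix \<sigma> i assume "\<sigma> \<in> {\<sigma>. \<sigma> permutes {..<d}}" and i: "i \<in> {..<d}"
  then have "\<sigma> i < d" using permutes_in_image[of \<sigma> "{..<d}" i] by blast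
  then show "X i (\<sigma> i) = mat_of d X $$ (i, \<sigma> i)" using i by simp
qed simp

lemma leibniz_det_permute_rows:
  assumes "\<tau> permutes {..<d}"
  shows "leibniz_det d (\<lambda>i. X (\<tau> i)) = of_int (sign \<tau>) * leibniz_det d X"
proof -
  have \<tau>: "\<tau> permutes {0..<d}" using assms by (simp add: atLeast0LessThan)
  have eq: "mat_of d (\<lambda>i. X (\<tau> i)) = mat d d (\<lambda>(i, j). mat_of d X $$ (\<tau> i, j))"
    using permutes_in_image[OF \<tau>] by (intro eq_matI) auto
  show ?thesis
    unfolding leibniz_det_eq_det eq by (rule det_permute_rows[OF mat_carrier \<tau>])
qed

lemma leibniz_det_transpose: "leibniz_det d (\<lambda>i j. X j i) = leibniz_det d X"
proof -
  have eq: "mat_of d (\<lambda>i j. X j i) = transpose_mat (mat_of d X)" by (intro eq_matI) auto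
  show ?thesis
    unfolding leibniz_det_eq_det eq by (rule det_transpose[OF mat_carrier])
qed

lemma leibniz_det_permute_both:
  assumes "\<tau> permutes {..<d}"
  shows "leibniz_det d (\<lambda>i j. X (\<tau> i) (\<tau> j)) = leibniz_det d X"
proof -
  have "leibniz_det d (\<lambda>i j. X (\<tau> i) (\<tau> j)) = of_int (sign \<tau>) * leibniz_det d (\<lambda>i j. X i (\<tau> j))"
    by (rule leibniz_det_permute_rows[OF assms, of "\<lambda>i j. X i (\<tau> j)"])
  also have "leibniz_det d (\<lambda>i j. X i (\<tau> j)) = leibniz_det d (\<lambda>i j. X j (\<tau> i))"
    by (rule leibniz_det_transpose[of d "\<lambda>i j. X j (\<tau> i)"])
  also have "\<dots> = of_int (sign \<tau>) * leibniz_det d (\<lambda>i j. X j i)"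
    by (rule leibniz_det_permute_rows[OF assms, of "\<lambda>i j. X j i"])
  also have "leibniz_det d (\<lambda>i j. X j i) = leibniz_det d X" by (rule leibniz_det_transpose)
  finally show ?thesis by (cases \<tau> rule: sign_cases) simp_all
qed

lemma leibniz_det_equal_rows:
  assumes "\<not> inj_on f {..<d}"
  shows "leibniz_det d (\<lambda>i. X (f i)) = 0"
proof -
  obtain i j where ij: "i < d" "j < d" "i \<noteq> j" "f i = f j" using assms by (auto simp: inj_on_def)
  have "Determinant.det (mat_of d (\<lambda>i. X (f i))) = 0"
    by (rule det_identical_rows[OF _ ij(3,1,2)]) (use ij in \<open>auto intro!: eq_vecI\<close>)
  then show ?thesis by (simp add: leibniz_det_eq_det)
qed

lemma cnj_leibniz_det: "cnj (leibniz_det d X) = leibniz_det d (\<lambda>i j. cnj (X i j))"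
  by (simp add: leibniz_det_def)

lemma arg_cong4: "a = a' \<Longrightarrow> b = b' \<Longrightarrow> c = c' \<Longrightarrow> d = d' \<Longrightarrow> f a b c d = f a' b' c' d'"
  by simp

text \<open>The block matrix is the product of \<open>diag(X, Y)\<close> and the matrix with rows \<open>(1, i)\<close> and \<open>(1, - i)\<close>, the
  latter of determinant \<open>(- 2 i)\<^sup>d\<close>.\<close>

lemma det_block_conjugate_columns:
  "Determinant.det (four_block_mat (mat_of d X) (\<i> \<cdot>\<^sub>m mat_of d X) (mat_of d Y) (- \<i> \<cdot>\<^sub>m mat_of d Y))
    = (- 2 * \<i>) ^ d * (leibniz_det d X * leibniz_det d Y)"
proof -
  let ?X = "mat_of d X" and ?Y = "mat_of d Y" and ?I = "1\<^sub>m d :: complex mat" and ?O = "0\<^sub>m d d :: complex mat"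
  have C: "?X \<in> carrier_mat d d" "?Y \<in> carrier_mat d d" "?O \<in> carrier_mat d d" "?I \<in> carrier_mat d d"
    "c \<cdot>\<^sub>m ?I \<in> carrier_mat d d" for c
    by auto
  have 1: "four_block_mat ?X (\<i> \<cdot>\<^sub>m ?X) ?Y (- \<i> \<cdot>\<^sub>m ?Y)
    = four_block_mat ?X ?O ?O ?Y * four_block_mat ?I (\<i> \<cdot>\<^sub>m ?I) ?I (- \<i> \<cdot>\<^sub>m ?I)"
    unfolding mult_four_block_mat[OF C(1,3,3,2,4,5,4,5)] by (intro arg_cong4[where f = four_block_mat] eq_matI) auto
  have 2: "four_block_mat ?I (\<i> \<cdot>\<^sub>m ?I) ?I (- \<i> \<cdot>\<^sub>m ?I)
    = four_block_mat ?I ?O ?I ?I * four_block_mat ?I (\<i> \<cdot>\<^sub>m ?I) ?O ((- 2 * \<i>) \<cdot>\<^sub>m ?I)"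
    unfolding mult_four_block_mat[OF C(4,3,4,4,4,5,3,5)] by (intro arg_cong4[where f = four_block_mat] eq_matI) auto
  have "Determinant.det (four_block_mat ?X ?O ?O ?Y) = Determinant.det ?X * Determinant.det ?Y"
    by (rule det_four_block_mat_upper_right_zero) auto
  moreover have "Determinant.det (four_block_mat ?I ?O ?I ?I) = 1"
    by (subst det_four_block_mat_upper_right_zero[where n = d and m = d]) auto
  moreover have "Determinant.det (four_block_mat ?I (\<i> \<cdot>\<^sub>m ?I) ?O ((- 2 * \<i>) \<cdot>\<^sub>m ?I)) = (- 2 * \<i>) ^ d"
    by (subst det_four_block_mat_lower_left_zero[where n = d and m = d]) auto
  ultimately show ?thesis
    unfolding 1 2 leibniz_det_eq_det
      det_mult[OF four_block_carrier_mat[OF C(1,2)] mult_carrier_mat[OF four_block_carrier_mat[OF C(4,4)]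
        four_block_carrier_mat[OF C(4,5)]]]
      det_mult[OF four_block_carrier_mat[OF C(4,4)] four_block_carrier_mat[OF C(4,5)]]
    by simp
qed

lemma prod_lessThan_double:
  fixes F :: "nat \<Rightarrow> 'a::comm_monoid_mult"
  shows "(\<Prod>r<2 * d. F r) = (\<Prod>i<d. F (2 * i) * F (2 * i + 1))"
  by (induction d) (simp_all add: mult_ac)

text \<open>The change from the order (even positions, then odd positions) to the natural one.\<close>

lemma interleave_permutes:
  fixes d :: nat
  shows   "(\<lambda>r. if r < d then 2 * r else if r < 2 * d then 2 * (r - d) + 1 else r) permutes {..<2 * d}"
    (is "?p permutes _")
proof (rule bij_imp_permutes)
  show "bij_betw ?p {..<2 * d} {..<2 * d}"
    by (rule bij_betw_byWitness[where f' = "\<lambda>r. if even r then r div 2 else d + r div 2"])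
      (auto elim!: evenE oddE)
qed auto

text \<open>Rows \<open>2 i\<close> and \<open>2 i + 1\<close> hold a linear form and its conjugate, columns \<open>2 a\<close> and \<open>2 a + 1\<close> a vector
  and \<open>\<i>\<close> times this vector. Sorting rows and columns by parity, with one permutation whose two signs
  cancel, exposes the block matrix with \<open>Y\<close> the conjugate of \<open>X\<close>.\<close>

lemma leibniz_det_conjugate_frame:
  defines "M \<equiv> \<lambda>X r c. (if even r then X (r div 2) (c div 2) * (if even c then 1 else \<i>)
      else cnj (X (r div 2) (c div 2) * (if even c then 1 else \<i>)))"
  shows "leibniz_det (2 * d) (M X) = (- 2 * \<i>) ^ d * (cmod (leibniz_det d X))\<^sup>2"
proof -
  define p where "p r = (if r < d then 2 * r else if r < 2 * d then 2 * (r - d) + 1 else r)" for r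
  have p: "p permutes {..<2 * d}" using interleave_permutes[of d] by (simp add: p_def[abs_def])
  let ?X = "mat_of d X" and ?Y = "mat_of d (\<lambda>i j. cnj (X i j))"
  have "leibniz_det (2 * d) (M X) = leibniz_det (2 * d) (\<lambda>i j. M X (p i) (p j))"
    by (rule leibniz_det_permute_both[OF p, symmetric])
  also have "\<dots> = Determinant.det (four_block_mat ?X (\<i> \<cdot>\<^sub>m ?X) ?Y (- \<i> \<cdot>\<^sub>m ?Y))"
  proof -
    have eq: "mat_of (2 * d) (\<lambda>i j. M X (p i) (p j))
      = four_block_mat ?X (\<i> \<cdot>\<^sub>m ?X) ?Y (- \<i> \<cdot>\<^sub>m ?Y)"
    by (rule eq_matI) (auto simp: four_block_mat_def M_def p_def)
    show ?thesis unfolding leibniz_det_eq_det eq ..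
  qed
  also have "\<dots> = (- 2 * \<i>) ^ d * (leibniz_det d X * cnj (leibniz_det d X))"
    unfolding cnj_leibniz_det by (rule det_block_conjugate_columns)
  finally show ?thesis by (simp add: complex_norm_square[symmetric] del: of_real_power)
qed

section \<open>The complex Hessian is Hermitian\<close>

definition second_derivative ::
    "('a::real_normed_vector \<Rightarrow> real) \<Rightarrow> 'a \<Rightarrow> 'a \<Rightarrow> 'a \<Rightarrow> real" where
  "second_derivative u z v w = frechet_derivative (\<lambda>x. frechet_derivative u (at x) v) (at z) w"

lemma has_derivative_along_line:
  fixes f :: "'a::real_normed_vector \<Rightarrow> real"
  assumes "f differentiable (at (a + s *\<^sub>R v))"
  shows "((\<lambda>s. f (a + s *\<^sub>R v)) has_real_derivative
    frechet_derivative f (at (a + s *\<^sub>R v)) v) (at s)"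
proof -
  let ?F = "frechet_derivative f (at (a + s *\<^sub>R v))"
  have F: "(f has_derivative ?F) (at (a + s *\<^sub>R v))"
    using assms by (simp add: frechet_derivative_works)
  have "((\<lambda>s. a + s *\<^sub>R v) has_derivative (\<lambda>h. h *\<^sub>R v)) (at s)"
    by (auto intro!: derivative_eq_intros)
  from has_derivative_compose[OF this F]
  have "((\<lambda>s. f (a + s *\<^sub>R v)) has_derivative (\<lambda>h. ?F (h *\<^sub>R v))) (at s)" .
  moreover have "?F (h *\<^sub>R v) = ?F v * h" for h
    using linear_scale[OF has_derivative_linear[OF F]] by simp
  ultimately show ?thesis by (simp add: has_field_derivative_def)
qed

text \<open>The mean value theorem, applied first in the direction \<open>v\<close> and then in the direction \<open>w\<close>.\<close>

lemma double_difference: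
  fixes u :: "'a::real_normed_vector \<Rightarrow> real"
  assumes d1: "\<And>x. x \<in> S \<Longrightarrow> u differentiable (at x)"
    and d2: "\<And>x. x \<in> S \<Longrightarrow> (\<lambda>y. frechet_derivative u (at y) v) differentiable (at x)"
    and S: "ball z r \<subseteq> S" and t: "0 < t" "t * (norm v + norm w) < r"
  shows "\<exists>p\<in>ball z r. u (z + t *\<^sub>R v + t *\<^sub>R w) - u (z + t *\<^sub>R v) - u (z + t *\<^sub>R w) + u z
    = t * t * second_derivative u p v w"
proof -
  have mem: "z + a *\<^sub>R v + b *\<^sub>R w \<in> ball z r" if "0 \<le> a" "a \<le> t" "0 \<le> b" "b \<le> t" for a b
  proof -
    have "norm (a *\<^sub>R v + b *\<^sub>R w) \<le> a * norm v + b * norm w"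
      using norm_triangle_ineq[of "a *\<^sub>R v" "b *\<^sub>R w"] that by simp
    also have "\<dots> \<le> t * norm v + t * norm w"
      using that by (intro add_mono mult_right_mono) auto
    finally have "norm (a *\<^sub>R v + b *\<^sub>R w) < r" using t by (simp add: distrib_left)
    moreover have "z - (z + a *\<^sub>R v + b *\<^sub>R w) = - (a *\<^sub>R v + b *\<^sub>R w)" by simp
    then have "dist z (z + a *\<^sub>R v + b *\<^sub>R w) = norm (a *\<^sub>R v + b *\<^sub>R w)"
      unfolding dist_norm by (simp only: norm_minus_cancel)
    ultimately show ?thesis by simp
  qed
  have der: "((\<lambda>s. u (z + s *\<^sub>R v + b *\<^sub>R w) - u (z + s *\<^sub>R v)) has_real_derivative
      frechet_derivative u (at (z + s *\<^sub>R v + b *\<^sub>R w)) v - frechet_derivative u (at (z + s *\<^sub>R v)) v) (at s)"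
    if "0 \<le> s" "s \<le> t" "0 \<le> b" "b \<le> t" for s b
  proof -
    have "u differentiable (at ((z + b *\<^sub>R w) + s *\<^sub>R v))" "u differentiable (at (z + s *\<^sub>R v))"
      using mem[of s b] mem[of s 0] that S t by (auto intro!: d1 simp: algebra_simps)
    from DERIV_diff[OF this[THEN has_derivative_along_line]]
    show ?thesis by (simp add: algebra_simps)
  qed
  obtain s where s: "0 < s" "s < t"
    "u (z + t *\<^sub>R v + t *\<^sub>R w) - u (z + t *\<^sub>R v) - (u (z + 0 *\<^sub>R v + t *\<^sub>R w) - u (z + 0 *\<^sub>R v))
    = (t - 0) * (frechet_derivative u (at (z + s *\<^sub>R v + t *\<^sub>R w)) v - frechet_derivative u (at (z + s *\<^sub>R v)) v)"
    using MVT2[OF t(1), of "\<lambda>s. u (z + s *\<^sub>R v + t *\<^sub>R w) - u (z + s *\<^sub>R v)"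
        "\<lambda>s. frechet_derivative u (at (z + s *\<^sub>R v + t *\<^sub>R w)) v - frechet_derivative u (at (z + s *\<^sub>R v)) v"]
      der t by auto
  have "((\<lambda>b. frechet_derivative u (at ((z + s *\<^sub>R v) + b *\<^sub>R w)) v) has_real_derivative
      second_derivative u ((z + s *\<^sub>R v) + b *\<^sub>R w) v w) (at b)" if "0 \<le> b" "b \<le> t" for b
    unfolding second_derivative_def
    by (rule has_derivative_along_line, rule d2) (use mem[of s b] s that S in auto)
  then obtain b where b: "0 < b" "b < t"
    "frechet_derivative u (at ((z + s *\<^sub>R v) + t *\<^sub>R w)) v - frechet_derivative u (at ((z + s *\<^sub>R v) + 0 *\<^sub>R w)) v
    = (t - 0) * second_derivative u ((z + s *\<^sub>R v) + b *\<^sub>R w) v w"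
    using MVT2[OF t(1), of "\<lambda>b. frechet_derivative u (at ((z + s *\<^sub>R v) + b *\<^sub>R w)) v"
        "\<lambda>b. second_derivative u ((z + s *\<^sub>R v) + b *\<^sub>R w) v w"] by auto
  show ?thesis
    by (rule bexI[of _ "z + s *\<^sub>R v + b *\<^sub>R w"]) (use s b mem[of s b] in auto)
qed

text \<open>The second difference is symmetric in \<open>v\<close> and \<open>w\<close>, so both second derivatives take a common value at
  points arbitrarily close to \<open>z\<close>, and both are continuous.\<close>

lemma second_derivative_symmetric:
  fixes u :: "'a::real_normed_vector \<Rightarrow> real"
  assumes C2: "C2_on S u" and S: "open S" "z \<in> S"
  shows "second_derivative u z v w = second_derivative u z w v"
proof (rule ccontr)
  assume ne: "second_derivative u z v w \<noteq> second_derivative u z w v"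
  define \<epsilon> where "\<epsilon> = \<bar>second_derivative u z v w - second_derivative u z w v\<bar> / 2"
  have \<epsilon>: "\<epsilon> > 0" using ne by (simp add: \<epsilon>_def)
  have cont: "continuous (at z) (\<lambda>x. second_derivative u x v w)" for v w
    using C2 S by (auto simp: C2_on_def second_derivative_def continuous_on_eq_continuous_at)
  obtain r1 where r1: "r1 > 0" "\<And>x. dist x z < r1 \<Longrightarrow> dist (second_derivative u x v w) (second_derivative u z v w) < \<epsilon>"
    using cont[of v w] \<epsilon> unfolding continuous_at_eps_delta by blast
  obtain r2 where r2: "r2 > 0" "\<And>x. dist x z < r2 \<Longrightarrow> dist (second_derivative u x w v) (second_derivative u z w v) < \<epsilon>"
    using cont[of w v] \<epsilon> unfolding continuous_at_eps_delta by blast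
  obtain r3 where r3: "r3 > 0" "ball z r3 \<subseteq> S" using S by (meson openE)
  define r where "r = min r1 (min r2 r3)"
  have r: "r > 0" "ball z r \<subseteq> S" using r1 r2 r3 by (auto simp: r_def)
  define t where "t = r / (norm v + norm w + 1)"
  have t: "t > 0" "t * (norm v + norm w) < r" "t * (norm w + norm v) < r"
    using r by (auto simp: t_def field_simps add_pos_nonneg intro!: divide_pos_pos)
  have d: "\<And>x. x \<in> S \<Longrightarrow> u differentiable (at x)"
    "\<And>x v. x \<in> S \<Longrightarrow> (\<lambda>y. frechet_derivative u (at y) v) differentiable (at x)"
    using C2 by (auto simp: C2_on_def)
  obtain p where p: "p \<in> ball z r" "u (z + t *\<^sub>R v + t *\<^sub>R w) - u (z + t *\<^sub>R v) - u (z + t *\<^sub>R w) + u z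
    = t * t * second_derivative u p v w"
    using double_difference[of S u v z r t w] d r t by blast
  obtain q where q: "q \<in> ball z r" "u (z + t *\<^sub>R w + t *\<^sub>R v) - u (z + t *\<^sub>R w) - u (z + t *\<^sub>R v) + u z
    = t * t * second_derivative u q w v"
    using double_difference[of S u w z r t v] d r t by blast
  have "t * t * second_derivative u p v w = t * t * second_derivative u q w v"
    using p(2) q(2) by (simp add: algebra_simps)
  then have "second_derivative u p v w = second_derivative u q w v" using t by simp
  moreover have "dist (second_derivative u p v w) (second_derivative u z v w) < \<epsilon>"
    using p(1) by (intro r1) (auto simp: r_def dist_commute)
  moreover have "dist (second_derivative u q w v) (second_derivative u z w v) < \<epsilon>"
    using q(1) by (intro r2) (auto simp: r_def dist_commute)
  ultimately show False unfolding \<epsilon>_def dist_real_def by (auto simp: abs_if split: if_splits)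
qed

lemma has_derivative_of_real:
  "(f has_derivative f') F \<Longrightarrow> ((\<lambda>x. complex_of_real (f x)) has_derivative (\<lambda>h. complex_of_real (f' h))) F"
  by (rule bounded_linear.has_derivative[OF bounded_linear_of_real])

lemma complex_hessian_eq_second_derivatives:
  fixes u :: "complex ^ 'n::finite \<Rightarrow> real"
  assumes d1: "\<And>x. x \<in> S \<Longrightarrow> u differentiable (at x)"
    and d2: "\<And>x v. x \<in> S \<Longrightarrow> (\<lambda>y. frechet_derivative u (at y) v) differentiable (at x)"
    and S: "open S" "z \<in> S"
  shows "complex_hessian u z $ p $ q =
    Complex (second_derivative u z (axis q 1) (axis p 1) + second_derivative u z (axis q \<i>) (axis p \<i>))
      (second_derivative u z (axis q \<i>) (axis p 1) - second_derivative u z (axis q 1) (axis p \<i>)) / 4"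
proof -
  let ?U = "\<lambda>x. complex_of_real (u x)"
  let ?g = "\<lambda>v x. frechet_derivative u (at x) v"
  have U: "frechet_derivative ?U (at x) v = of_real (?g v x)" if "x \<in> S" for x v
    using has_derivative_of_real[OF d1[OF that, unfolded frechet_derivative_works]]
    by (simp add: frechet_derivative_at[symmetric])
  have A: "((\<lambda>x. complex_of_real (?g v x)) has_derivative (\<lambda>w. of_real (second_derivative u z v w))) (at z)" for v
    unfolding second_derivative_def
    by (rule has_derivative_of_real) (use d2 S in \<open>auto simp: frechet_derivative_works[symmetric]\<close>)
  have "d_zbar q ?U x = (of_real (?g (axis q 1) x) + \<i> * of_real (?g (axis q \<i>) x)) / 2" if "x \<in> S" for x
    by (simp add: d_zbar_def U[OF that])
  moreover have "((\<lambda>x. (complex_of_real (?g (axis q 1) x) + \<i> * of_real (?g (axis q \<i>) x)) / 2) has_derivative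
      (\<lambda>w. (of_real (second_derivative u z (axis q 1) w) + \<i> * of_real (second_derivative u z (axis q \<i>) w)) / 2)) (at z)"
    using has_derivative_mult_right[OF has_derivative_add[OF A has_derivative_mult_right[OF A]], of "1 / 2" _ "\<i>"]
    by (simp add: mult.commute[of _ "1/2"])
  ultimately have "(d_zbar q ?U has_derivative
      (\<lambda>w. (of_real (second_derivative u z (axis q 1) w) + \<i> * of_real (second_derivative u z (axis q \<i>) w)) / 2)) (at z)"
    using S by (elim has_derivative_transform_within_open) auto
  from frechet_derivative_at[OF this, symmetric] show ?thesis
    by (simp add: complex_hessian_def d_z_def complex_eq_iff)
qed

lemma complex_hessian_hermitian:
  fixes u :: "complex ^ 'n::finite \<Rightarrow> real"
  assumes C2: "C2_on S u" and S: "open S" "z \<in> S"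
  shows "complex_hessian u z $ q $ p = cnj (complex_hessian u z $ p $ q)"
proof -
  have d: "\<And>x. x \<in> S \<Longrightarrow> u differentiable (at x)"
    "\<And>x v. x \<in> S \<Longrightarrow> (\<lambda>y. frechet_derivative u (at y) v) differentiable (at x)"
    using C2 by (auto simp: C2_on_def)
  note sym = second_derivative_symmetric[OF assms]
  have H: "complex_hessian u z $ p $ q =
    Complex (second_derivative u z (axis q 1) (axis p 1) + second_derivative u z (axis q \<i>) (axis p \<i>))
      (second_derivative u z (axis q \<i>) (axis p 1) - second_derivative u z (axis q 1) (axis p \<i>)) / 4" for p q
    by (rule complex_hessian_eq_second_derivatives[OF _ _ S]) (use d in auto)
  show ?thesis
    unfolding H[of p q] H[of q p] sym[of "axis p 1"] sym[of "axis p \<i>"]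
    by (simp add: complex_eq_iff)
qed

lemma complex_hessian_norm_squared:
  fixes z :: "complex ^ 'n::finite"
  shows "complex_hessian (\<lambda>x. (norm x)\<^sup>2) z $ p $ q = (if p = q then 1 else 0)"
proof -
  let ?N = "\<lambda>x :: complex ^ 'n. (norm x)\<^sup>2"
  have 1: "(?N has_derivative (\<lambda>v. 2 * (x \<bullet> v))) (at x)" for x
    unfolding power2_norm_eq_inner
    by (auto intro!: derivative_eq_intros simp: inner_commute)
  have F: "frechet_derivative ?N (at x) v = 2 * (x \<bullet> v)" for x v
    using frechet_derivative_at[OF 1, symmetric] by simp
  have 2: "((\<lambda>x. frechet_derivative ?N (at x) v) has_derivative (\<lambda>w. 2 * (w \<bullet> v))) (at x)" for x v
    unfolding F by (auto intro!: derivative_eq_intros)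
  have "second_derivative ?N z v w = 2 * (w \<bullet> v)" for v w
    unfolding second_derivative_def using frechet_derivative_at[OF 2, symmetric] by simp
  moreover have "?N differentiable (at x)" for x
    using 1 by (auto simp: differentiable_def)
  moreover have "(\<lambda>x. frechet_derivative ?N (at x) v) differentiable (at x)" for x v
    using 2[of v x] unfolding differentiable_def by blast
  ultimately show ?thesis
    by (subst complex_hessian_eq_second_derivatives[where S = UNIV])
      (auto simp: inner_axis_axis complex_eq_iff)
qed


section \<open>Unitary diagonalization\<close>

definition cinner :: "complex ^ 'n::finite \<Rightarrow> complex ^ 'n \<Rightarrow> complex" where
  "cinner x y = (\<Sum>r\<in>UNIV. x $ r * cnj (y $ r))"

lemma cinner_simps:
  "cinner (x + y) z = cinner x z + cinner y z" "cinner z (x + y) = cinner z x + cinner z y"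
  "cinner (x - y) z = cinner x z - cinner y z" "cinner z (x - y) = cinner z x - cinner z y"
  "cinner (c *s x) y = c * cinner x y" "cinner x (c *s y) = cnj c * cinner x y"
  "cinner (a *\<^sub>R x) y = of_real a * cinner x y" "cinner x (a *\<^sub>R y) = of_real a * cinner x y"
  by (simp_all add: cinner_def algebra_simps sum.distrib sum_subtractf sum_distrib_left
      scaleR_conv_of_real[where 'a = complex])

lemma cinner_sym: "cinner y x = cnj (cinner x y)"
  by (simp add: cinner_def mult.commute)

lemma Re_cinner: "Re (cinner x y) = x \<bullet> y"
  by (simp add: cinner_def inner_vec_def inner_complex_def)

lemma cinner_self: "cinner x x = of_real ((norm x)\<^sup>2)"
  unfolding complex_eq_iff
  by (simp add: Re_cinner power2_norm_eq_inner)
    (metis cinner_sym complex_cnj_cancel_iff complex_cnj_one Im_complex_of_real cnj.simps(2) neg_equal_zero)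

lemma continuous_on_cinner [continuous_intros]:
  "continuous_on S f \<Longrightarrow> continuous_on S g \<Longrightarrow> continuous_on S (\<lambda>x. cinner (f x) (g x))"
  unfolding cinner_def by (intro continuous_intros)

text \<open>Orthogonality for the complex inner product is real orthogonality to \<open>e i\<close> and \<open>\<i> e i\<close>, which are too
  few vectors to span the real space of dimension \<open>2 n\<close>.\<close>

lemma exists_cinner_orthogonal:
  fixes e :: "nat \<Rightarrow> complex ^ 'n::finite"
  assumes "m < CARD('n)"
  obtains x where "x \<noteq> 0" "\<And>i. i < m \<Longrightarrow> cinner x (e i) = 0"
proof -
  let ?S = "e ` {..<m} \<union> (\<lambda>i. \<i> *s e i) ` {..<m}"
  have "dim ?S \<le> card ?S" by (rule dim_le_card') simp
  also have "\<dots> \<le> card (e ` {..<m}) + card ((\<lambda>i. \<i> *s e i) ` {..<m})" by (rule card_Un_le)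
  also have "\<dots> \<le> m + m" by (intro add_mono) (metis card_image_le finite_lessThan card_lessThan)+
  also have "\<dots> < DIM(complex ^ 'n)" using assms by simp
  finally obtain x where x: "x \<noteq> 0" "\<And>y. y \<in> span ?S \<Longrightarrow> x \<bullet> y = 0"
    using orthogonal_to_subspace_exists unfolding Linear_Algebra.orthogonal_def by blast
  have "cinner x (e i) = 0" if "i < m" for i
  proof -
    have "x \<bullet> e i = 0" "x \<bullet> (\<i> *s e i) = 0"
      using x(2)[OF span_base, of "e i"] x(2)[OF span_base, of "\<i> *s e i"] that
      by auto
    then show ?thesis by (simp add: complex_eq_iff cinner_simps flip: Re_cinner)
  qed
  with x(1) show ?thesis using that by blast
qed

text \<open>The value \<open>t = - a / (\<bar>B\<bar> + 1)\<close> makes the expression negative unless \<open>a = 0\<close>.\<close>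

lemma linear_part_zero_of_nonneg:
  fixes a B :: real
  assumes "\<And>t. 0 \<le> 2 * t * a + t\<^sup>2 * B"
  shows "a = 0"
proof (rule ccontr)
  assume "a \<noteq> 0"
  define c where "c = \<bar>B\<bar> + 1"
  have c: "c > 0" by (simp add: c_def)
  have "0 \<le> 2 * (- a / c) * a + (- a / c)\<^sup>2 * B" by (rule assms)
  also have "\<dots> = a\<^sup>2 / c * (B / c - 2)" using c by (simp add: field_simps power2_eq_square)
  finally have "0 \<le> B / c - 2" using \<open>a \<noteq> 0\<close> c by (simp add: zero_le_mult_iff zero_le_divide_iff)
  moreover have "B / c \<le> 1" using c by (simp add: c_def)
  ultimately show False by simp
qed

text \<open>The next eigenvector maximizes \<open>x \<mapsto> T x \<bullet> x\<close> on the unit sphere of the orthogonal complement \<open>V\<close>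
  of the previous ones. With \<open>M\<close> the maximum, \<open>b(x, y) = M (x \<bullet> y) - T x \<bullet> y\<close> is positive
  semidefinite on \<open>V\<close> and vanishes at the maximizer \<open>x0\<close>, so \<open>x0\<close> is \<open>b\<close>-orthogonal to \<open>V\<close>; and
  \<open>M x0 - T x0\<close> lies in \<open>V\<close>.\<close>

lemma self_adjoint_orthonormal_eigenvectors:
  fixes T :: "complex ^ 'n::finite \<Rightarrow> complex ^ 'n"
  assumes lin: "linear T" and adj: "\<And>x y. cinner (T x) y = cinner x (T y)"
    and m: "m \<le> CARD('n)"
  shows "\<exists>e l. (\<forall>i<m. T (e i) = complex_of_real (l i) *s e i) \<and>
    (\<forall>i<m. \<forall>j<m. cinner (e i) (e j) = (if i = j then 1 else 0))"
  using m
proof (induction m)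
  case 0
  then show ?case by simp
next
  case (Suc m)
  then obtain e l where e: "\<And>i. i < m \<Longrightarrow> T (e i) = complex_of_real (l i) *s e i"
    "\<And>i j. i < m \<Longrightarrow> j < m \<Longrightarrow> cinner (e i) (e j) = (if i = j then 1 else 0)"
    by auto
  define V where "V = {x. \<forall>i<m. cinner x (e i) = 0}"
  define Q where "Q x = T x \<bullet> x" for x
  have contT: "continuous_on A T" for A
    using lin linear_continuous_on linear_conv_bounded_linear by blast
  have V_lin: "x + a *\<^sub>R y \<in> V" "a *\<^sub>R x \<in> V" if "x \<in> V" "y \<in> V" for x y a
    using that by (auto simp: V_def cinner_simps)
  have "closed V"
    unfolding V_def Collect_all_eq by (intro closed_INT ballI closed_Collect_imp closed_Collect_eq continuous_intros) auto
  then have "compact (V \<inter> sphere 0 1)" by (simp add: closed_Int_compact)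
  moreover obtain x where x: "x \<noteq> 0" "\<And>i. i < m \<Longrightarrow> cinner x (e i) = 0"
    using exists_cinner_orthogonal[of m e] Suc.prems by auto
  then have "(1 / norm x) *\<^sub>R x \<in> V \<inter> sphere 0 1" by (auto simp: V_def cinner_simps)
  moreover have "continuous_on (V \<inter> sphere 0 1) Q"
    unfolding Q_def by (intro continuous_intros contT)
  ultimately obtain x0 where x0: "x0 \<in> V" "norm x0 = 1"
    and max: "\<And>y. y \<in> V \<Longrightarrow> norm y = 1 \<Longrightarrow> Q y \<le> Q x0"
    using continuous_attains_sup[of "V \<inter> sphere 0 1" Q] by fastforce
  define M where "M = Q x0"
  define b where "b x y = M * (x \<bullet> y) - T x \<bullet> y" for x y
  have Tadj: "T x \<bullet> y = x \<bullet> T y" for x y by (simp add: adj flip: Re_cinner)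
  have b_nonneg: "0 \<le> b y y" if "y \<in> V" for y
  proof (cases "y = 0")
    case True
    then show ?thesis by (simp add: b_def)
  next
    case False
    have "Q ((1 / norm y) *\<^sub>R y) \<le> M"
      unfolding M_def using False V_lin(2)[OF that that] by (intro max) auto
    then have "(T y \<bullet> y) / (norm y)\<^sup>2 \<le> M"
      by (simp add: Q_def linear_scale[OF lin] power2_eq_square)
    then show ?thesis using False by (simp add: b_def power2_norm_eq_inner[symmetric] field_simps)
  qed
  have b0: "b x0 x0 = 0" using x0(2) by (simp add: b_def M_def Q_def power2_norm_eq_inner[symmetric])
  have b_orth: "b x0 y = 0" if "y \<in> V" for y
  proof (rule linear_part_zero_of_nonneg)
    fix t
    have "b (x0 + t *\<^sub>R y) (x0 + t *\<^sub>R y) = b x0 x0 + 2 * t * b x0 y + t\<^sup>2 * b y y"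
      unfolding b_def linear_add[OF lin] linear_scale[OF lin]
      by (simp add: inner_add_left inner_add_right Tadj[of x0 y] inner_commute[of "T y"] inner_commute[of y x0] algebra_simps power2_eq_square)
    then show "0 \<le> 2 * t * b x0 y + t\<^sup>2 * b y y"
      using b_nonneg[OF V_lin(1)[OF x0(1) that], of t] b0 by linarith
  qed
  define r where "r = M *\<^sub>R x0 - T x0"
  have "r \<in> V"
    using x0(1) e(1) by (auto simp: r_def V_def cinner_simps adj)
  then have "r \<bullet> r = 0" using b_orth[of r] by (simp add: b_def r_def inner_diff_left)
  then have eig: "T x0 = complex_of_real M *s x0"
    by (simp add: r_def Finite_Cartesian_Product.vec_eq_iff scaleR_conv_of_real[where 'a = complex])
  have "cinner x0 (e i) = 0" "cinner (e i) x0 = 0" if "i < m" for i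
    using x0(1) that cinner_sym[of "e i" x0] by (auto simp: V_def)
  moreover have "cinner x0 x0 = 1" using x0(2) by (simp add: cinner_self)
  ultimately have "(\<forall>i<Suc m. T ((e(m := x0)) i) = complex_of_real ((l(m := M)) i) *s (e(m := x0)) i) \<and>
      (\<forall>i<Suc m. \<forall>j<Suc m. cinner ((e(m := x0)) i) ((e(m := x0)) j) = (if i = j then 1 else 0))"
    using e eig by (auto simp: less_Suc_eq)
  then show ?case by blast
qed

text \<open>The second conclusion is Parseval's identity: it says that the Euclidean form is diagonal in the same
  basis, with all coefficients equal to \<open>1\<close>. The third one follows from it because \<open>T x\<close> has the
  coordinates of \<open>x\<close> multiplied by the eigenvalues.\<close>

lemma hermitian_diagonalization:
  fixes A :: "complex ^ 'n::finite ^ 'n"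
  assumes herm: "\<And>p q. A $ q $ p = cnj (A $ p $ q)"
  obtains e :: "'n \<Rightarrow> complex ^ 'n" and l :: "'n \<Rightarrow> real"
  where "\<And>p q. cinner (e p) (e q) = (if p = q then 1 else 0)"
    and "\<And>x y. cinner x y = (\<Sum>p\<in>UNIV. cinner x (e p) * cnj (cinner y (e p)))"
    and "\<And>x y. (\<Sum>p\<in>UNIV. \<Sum>q\<in>UNIV. A $ p $ q * (x $ p * cnj (y $ q)))
      = (\<Sum>p\<in>UNIV. of_real (l p) * (cinner x (e p) * cnj (cinner y (e p))))"
proof -
  define T where "T x = (\<chi> q. \<Sum>p\<in>UNIV. A $ p $ q * x $ p)" for x :: "complex ^ 'n"
  have form: "cinner (T x) y = (\<Sum>p\<in>UNIV. \<Sum>q\<in>UNIV. A $ p $ q * (x $ p * cnj (y $ q)))" for x y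
    unfolding cinner_def T_def by (simp add: sum_distrib_right mult.assoc) (rule sum.swap)
  have "linear T"
    by (rule linearI; unfold T_def Finite_Cartesian_Product.vec_eq_iff)
      (simp_all add: distrib_left sum.distrib scaleR_conv_of_real[where 'a = complex] sum_distrib_left mult_ac)
  moreover have adj: "cinner (T x) y = cinner x (T y)" for x y
  proof -
    have "cinner x (T y) = cnj (cinner (T y) x)" by (rule cinner_sym)
    also have "\<dots> = (\<Sum>p\<in>UNIV. \<Sum>q\<in>UNIV. A $ q $ p * (x $ q * cnj (y $ p)))"
      unfolding form by (simp add: herm[symmetric] mult_ac)
    also have "\<dots> = cinner (T x) y" unfolding form by (rule sum.swap)
    finally show ?thesis by simp
  qed
  ultimately obtain f k where f: "\<And>i. i < CARD('n) \<Longrightarrow> T (f i) = complex_of_real (k i) *s f i"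
    "\<And>i j. i < CARD('n) \<Longrightarrow> j < CARD('n) \<Longrightarrow> cinner (f i) (f j) = (if i = j then 1 else 0)"
    using self_adjoint_orthonormal_eigenvectors[of T "CARD('n)"] by blast
  obtain h :: "'n \<Rightarrow> nat" where h: "bij_betw h UNIV {..<CARD('n)}"
    using ex_bij_betw_finite_nat[of "UNIV :: 'n set"] by (auto simp: atLeast0LessThan)
  define e where "e p = f (h p)" for p
  define l where "l p = k (h p)" for p
  have hl: "h p < CARD('n)" "h p = h q \<longleftrightarrow> p = q" for p q
    using h by (auto simp: bij_betw_def inj_def)
  have e: "cinner (e p) (e q) = (if p = q then 1 else 0)" and T: "T (e p) = complex_of_real (l p) *s e p" for p q
    unfolding e_def l_def using f hl by auto
  define U :: "complex ^ 'n ^ 'n" where "U = (\<chi> p r. cnj (e p $ r))"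
  define W :: "complex ^ 'n ^ 'n" where "W = (\<chi> r p. e p $ r)"
  have "U ** W = Finite_Cartesian_Product.mat 1"
    using e by (auto simp: Finite_Cartesian_Product.vec_eq_iff matrix_matrix_mult_def U_def W_def Finite_Cartesian_Product.mat_def cinner_def mult.commute)
  then have "W ** U = Finite_Cartesian_Product.mat 1" by (simp add: matrix_left_right_inverse)
  then have complete: "(\<Sum>p\<in>UNIV. e p $ r * cnj (e p $ s)) = (if r = s then 1 else 0)" for r s
    by (simp add: Finite_Cartesian_Product.vec_eq_iff matrix_matrix_mult_def U_def W_def Finite_Cartesian_Product.mat_def)
  have parseval: "cinner x y = (\<Sum>p\<in>UNIV. cinner x (e p) * cnj (cinner y (e p)))" for x y
  proof -
    have "(\<Sum>p\<in>UNIV. cinner x (e p) * cnj (cinner y (e p)))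
      = (\<Sum>p\<in>UNIV. \<Sum>s\<in>UNIV. \<Sum>r\<in>UNIV. x $ s * cnj (y $ r) * (e p $ r * cnj (e p $ s)))"
      by (simp add: cinner_def sum_product mult_ac)
    also have "\<dots> = (\<Sum>s\<in>UNIV. \<Sum>r\<in>UNIV. x $ s * cnj (y $ r) * (\<Sum>p\<in>UNIV. e p $ r * cnj (e p $ s)))"
      unfolding sum_distrib_left by (subst sum.swap, rule sum.cong[OF refl], rule sum.swap)
    also have "\<dots> = cinner x y"
      by (simp add: complete cinner_def if_distrib[of "(*) _"] sum.delta' cong: if_cong)
    finally show ?thesis by simp
  qed
  show ?thesis
  proof (rule that[OF e parseval])
    fix x y
    have "cinner (T x) (e p) = of_real (l p) * cinner x (e p)" for p
      by (simp add: adj T cinner_simps)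
    then show "(\<Sum>p\<in>UNIV. \<Sum>q\<in>UNIV. A $ p $ q * (x $ p * cnj (y $ q)))
      = (\<Sum>p\<in>UNIV. of_real (l p) * (cinner x (e p) * cnj (cinner y (e p))))"
      unfolding form[symmetric] parseval[of "T x" y] by (simp add: mult.assoc)
  qed
qed

section \<open>The forms in terms of the eigenvalues\<close>

lemma depends_on_first_dz: "depends_on_first 1 (dz p)" "depends_on_first 1 (dzbar p)"
  by (auto simp: depends_on_first_def dz_def dzbar_def)

lemma i_ddbar_alternation:
  "i_ddbar u z = alternation 2 (\<lambda>v. \<i> * (\<Sum>p\<in>UNIV. \<Sum>q\<in>UNIV.
    complex_hessian u z $ p $ q * (v 0 $ p * cnj (v 1 $ q))))"
proof
  fix v :: "nat \<Rightarrow> complex ^ 'a"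
  have "wedge 1 1 (dz p) (dzbar q) = alternation 2 (\<lambda>v. v 0 $ p * cnj (v 1 $ q))" for p q :: 'a
  proof -
    have "wedge 1 1 (dz p) (dzbar q) = wedge 1 1 (alternation 1 (dz p)) (alternation 1 (dzbar q))"
      by (simp only: alternation_1 depends_on_first_dz)
    also have "\<dots> = alternation (1 + 1) (\<lambda>v. dz p v * dzbar q (\<lambda>i. v (1 + i)))"
      by (rule wedge_alternation[OF depends_on_first_dz])
    finally show ?thesis by (simp add: dz_def dzbar_def numeral_2_eq_2)
  qed
  then show "i_ddbar u z v = alternation 2 (\<lambda>v. \<i> * (\<Sum>p\<in>UNIV. \<Sum>q\<in>UNIV.
    complex_hessian u z $ p $ q * (v 0 $ p * cnj (v 1 $ q)))) v"
    by (simp add: i_ddbar_def alternation_cmult alternation_sum)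
qed

abbreviation complex_frame :: "(nat \<Rightarrow> complex ^ 'n) \<Rightarrow> nat \<Rightarrow> complex ^ 'n::finite" where
  "complex_frame w \<equiv> (\<lambda>i. if even i then w (i div 2) else \<i> *s w (i div 2))"

text \<open>The alternation is a \<open>2 d \<times> 2 d\<close> determinant, with the linear forms given by \<open>b\<close> and their conjugates
  in the rows.\<close>

lemma alternation_frame:
  "alternation (2 * d) (\<lambda>v. \<Prod>i<d. cinner (v (2 * i)) (b i) * cnj (cinner (v (2 * i + 1)) (b i))) (complex_frame w)
    = (- 2 * \<i>) ^ d * (cmod (leibniz_det d (\<lambda>i a. cinner (w a) (b i))))\<^sup>2"
proof -
  have c: "cinner (complex_frame w c) (b i)
      = cinner (w (c div 2)) (b i) * (if even c then 1 else \<i>)" for c i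
    by (simp add: cinner_simps)
  show ?thesis
    unfolding leibniz_det_conjugate_frame[symmetric]
    unfolding alternation_def leibniz_det_def prod_lessThan_double c by simp
qed

text \<open>The squared modulus of the \<open>d \<times> d\<close> minor of the coordinates of \<open>w\<close> in the basis \<open>e\<close> that is
  selected by the indices \<open>f 0, \<dots>, f (d - 1)\<close>.\<close>

definition det_weight ::
    "nat \<Rightarrow> ('n::finite \<Rightarrow> complex ^ 'n) \<Rightarrow> (nat \<Rightarrow> complex ^ 'n) \<Rightarrow> (nat \<Rightarrow> 'n) \<Rightarrow> real" where
  "det_weight d e w f = (cmod (leibniz_det d (\<lambda>i a. cinner (w a) (e (f i)))))\<^sup>2"

text \<open>Multiplying out the \<open>d\<close> sums over the eigenbasis gives one term for each choice \<open>f\<close> of a basis vector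
  in each factor. The factor \<open>\<i>\<^sup>d\<close> from the definition of the forms cancels the phase in
  \<open>alternation_frame\<close>.\<close>

lemma hessian_form_frame:
  fixes u :: "complex ^ 'n::finite \<Rightarrow> real" and e :: "'n \<Rightarrow> complex ^ 'n" and l :: "'n \<Rightarrow> real"
  assumes parseval: "\<And>x y. cinner x y = (\<Sum>p\<in>UNIV. cinner x (e p) * cnj (cinner y (e p)))"
    and diag: "\<And>x y. (\<Sum>p\<in>UNIV. \<Sum>q\<in>UNIV. complex_hessian u z $ p $ q * (x $ p * cnj (y $ q)))
      = (\<Sum>p\<in>UNIV. of_real (l p) * (cinner x (e p) * cnj (cinner y (e p))))"
  shows "hessian_form j m u z (complex_frame w) = of_real (2 ^ (j + m) *
    (\<Sum>f\<in>{..<j + m} \<rightarrow>\<^sub>E UNIV. (\<Prod>i<j. l (f i)) * det_weight (j + m) e w f))"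
proof -
  define d where "d = j + m"
  define c where "c i p = \<i> * (if i < j then of_real (l p) else 1)" for i p
  define \<theta> where "\<theta> p x y = cinner x (e p) * cnj (cinner y (e p))" for p x y
  have N: "i_ddbar (\<lambda>x :: complex ^ 'n. (norm x)\<^sup>2) z
      = alternation 2 (\<lambda>v. \<Sum>p\<in>UNIV. \<i> * \<theta> p (v 0) (v 1))"
    unfolding i_ddbar_alternation complex_hessian_norm_squared \<theta>_def sum_distrib_left[symmetric] parseval[symmetric]
    by (simp add: cinner_def if_distrib[of "\<lambda>x. x * _"] cong: if_cong)
  have U: "i_ddbar u z = alternation 2 (\<lambda>v. \<Sum>p\<in>UNIV. \<i> * of_real (l p) * \<theta> p (v 0) (v 1))"
    unfolding i_ddbar_alternation \<theta>_def diag by (simp add: sum_distrib_left mult.assoc)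
  have "hessian_form j m u z = alternation (2 * d) (\<lambda>v. \<Prod>i<d. \<Sum>p\<in>UNIV. c i p * \<theta> p (v (2 * i)) (v (2 * i + 1)))"
    unfolding hessian_form_def d_def
    by (subst wedge_powers_alternation[OF U N]) (auto simp: c_def intro!: arg_cong[where f = "alternation _"] prod.cong)
  also have "\<dots> = alternation (2 * d) (\<lambda>v. \<Sum>f\<in>{..<d} \<rightarrow>\<^sub>E UNIV. (\<Prod>i<d. c i (f i)) *
      (\<Prod>i<d. \<theta> (f i) (v (2 * i)) (v (2 * i + 1))))"
    by (subst prod_sum_PiE) (simp_all add: prod.distrib)
  finally have 1: "hessian_form j m u z (complex_frame w) = (\<Sum>f\<in>{..<d} \<rightarrow>\<^sub>E UNIV. (\<Prod>i<d. c i (f i)) *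
      ((- 2 * \<i>) ^ d * (cmod (leibniz_det d (\<lambda>i a. cinner (w a) (e (f i)))))\<^sup>2))"
    unfolding \<theta>_def
    by (simp only: alternation_sum alternation_cmult)
      (intro sum.cong[OF refl] arg_cong2[where f = "(*)"] refl alternation_frame)
  have "(\<Prod>i<d. c i (f i)) = \<i> ^ d * of_real (\<Prod>i<j. l (f i))" for f
  proof -
    have "(\<Prod>i<d. if i < j then complex_of_real (l (f i)) else 1) = (\<Prod>i\<in>{..<d} \<inter> {i. i < j}. of_real (l (f i)))"
      by (subst prod.inter_restrict) (auto)
    also have "{..<d} \<inter> {i. i < j} = {..<j}" by (auto simp: d_def)
    finally show ?thesis by (simp add: c_def prod.distrib)
  qed
  moreover have "\<i> ^ d * (- 2 * \<i>) ^ d = (2 :: complex) ^ d"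
  proof -
    have "\<i> * (- 2 * \<i>) = 2" by (simp add: complex_eq_iff)
    then show ?thesis by (simp only: power_mult_distrib[symmetric])
  qed
  ultimately have "(\<Prod>i<d. c i (f i)) * ((- 2 * \<i>) ^ d * of_real (det_weight d e w f))
      = of_real (2 ^ d * ((\<Prod>i<j. l (f i)) * det_weight d e w f))" for f
    by (simp add: mult_ac)
  note summand = this
  show ?thesis
    unfolding 1 det_weight_def[symmetric] summand by (simp only: d_def[symmetric] sum_distrib_left of_real_sum)
qed

lemma leibniz_det_cong:
  "(\<And>i a. i < d \<Longrightarrow> a < d \<Longrightarrow> X i a = Y i a) \<Longrightarrow> leibniz_det d X = leibniz_det d Y"
  unfolding leibniz_det_def
  by (intro sum.cong refl arg_cong2[where f = "(*)"] prod.cong) (use permutes_in_image in fastforce)+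

lemma det_weight_nonneg: "0 \<le> det_weight d e w f"
  by (simp add: det_weight_def)

lemma det_weight_eq_0: "\<not> inj_on f {..<d} \<Longrightarrow> det_weight d e w f = 0"
  using leibniz_det_equal_rows[of f d "\<lambda>p a. cinner (w a) (e p)"] by (simp add: det_weight_def)

lemma det_weight_permute:
  assumes "\<tau> permutes {..<d}"
  shows "det_weight d e w (f \<circ> \<tau>) = det_weight d e w f"
proof -
  have "leibniz_det d (\<lambda>i a. cinner (w a) (e ((f \<circ> \<tau>) i)))
      = of_int (sign \<tau>) * leibniz_det d (\<lambda>i a. cinner (w a) (e (f i)))"
    using leibniz_det_permute_rows[OF assms, of "\<lambda>i a. cinner (w a) (e (f i))"] by simp
  then show ?thesis by (cases \<tau> rule: sign_cases) (simp_all add: det_weight_def)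
qed

text \<open>On a frame of distinct basis vectors only the choices with the same set of indices survive.\<close>

lemma det_weight_dual_basis:
  assumes e: "\<And>p q. cinner (e p) (e q) = (if p = q then 1 else 0)" and g: "inj_on g {..<d}"
  shows "det_weight d e (\<lambda>a. e (g a)) g = 1"
    and "det_weight d e (\<lambda>a. e (g a)) f \<noteq> 0 \<Longrightarrow> inj_on f {..<d} \<and> f ` {..<d} = g ` {..<d}"
proof -
  have "leibniz_det d (\<lambda>i a. cinner (e (g a)) (e (g i))) = leibniz_det d (\<lambda>i a. if i = a then 1 else 0)"
    using g by (intro leibniz_det_cong) (auto simp: e inj_on_def)
  also have "\<dots> = (\<Sum>\<sigma>\<in>{id}. of_int (sign \<sigma>) * (\<Prod>i<d. if i = \<sigma> i then 1 else 0))"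
    unfolding leibniz_det_def
  proof (rule sum.mono_neutral_right)
    have "\<exists>i<d. i \<noteq> \<sigma> i" if "\<sigma> permutes {..<d}" "\<sigma> \<noteq> id" for \<sigma>
      using that permutes_not_in[OF that(1)] by (force simp: fun_eq_iff)
    then show "\<forall>\<sigma>\<in>{\<sigma>. \<sigma> permutes {..<d}} - {id}. complex_of_int (sign \<sigma>) * (\<Prod>i<d. if i = \<sigma> i then 1 else 0) = 0"
      by auto
  qed (auto simp: finite_permutations permutes_id)
  finally show "det_weight d e (\<lambda>a. e (g a)) g = 1" by (simp add: det_weight_def)
next
  assume nz: "det_weight d e (\<lambda>a. e (g a)) f \<noteq> 0"
  have inj: "inj_on f {..<d}" using nz det_weight_eq_0 by blast
  have "f i \<in> g ` {..<d}" if "i < d" for i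
  proof (rule ccontr)
    assume "f i \<notin> g ` {..<d}"
    then have "cinner (e (g a)) (e (f i)) = 0" if "a < d" for a using that by (metis e image_eqI lessThan_iff)
    then have "(\<Prod>r<d. cinner (e (g (\<sigma> r))) (e (f r))) = 0" if "\<sigma> permutes {..<d}" for \<sigma>
      using that \<open>i < d\<close> permutes_in_image[OF that, of i] by (intro prod_zero) auto
    then have "leibniz_det d (\<lambda>i a. cinner (e (g a)) (e (f i))) = 0"
      unfolding leibniz_det_def by (intro sum.neutral ballI) (simp del: prod_zero_iff)
    then show False using nz by (simp add: det_weight_def)
  qed
  then have "f ` {..<d} \<subseteq> g ` {..<d}" by auto
  then have "f ` {..<d} = g ` {..<d}"
    using inj g by (intro card_subset_eq) (auto simp: card_image)
  with inj show "inj_on f {..<d} \<and> f ` {..<d} = g ` {..<d}" by blast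
qed

lemma sum_PiE_permute:
  fixes F :: "(nat \<Rightarrow> 'n::finite) \<Rightarrow> real"
  assumes \<tau>: "\<tau> permutes {..<d}"
  shows "(\<Sum>f\<in>{..<d} \<rightarrow>\<^sub>E UNIV. F (f \<circ> \<tau>)) = (\<Sum>f\<in>{..<d} \<rightarrow>\<^sub>E UNIV. F f)"
proof (rule sum.reindex_bij_witness[of _ "\<lambda>f. f \<circ> Hilbert_Choice.inv \<tau>" "\<lambda>f. f \<circ> \<tau>"])
  have PiE: "f \<circ> \<sigma> \<in> {..<d} \<rightarrow>\<^sub>E (UNIV :: 'n set)" if "f \<in> {..<d} \<rightarrow>\<^sub>E UNIV" "\<sigma> permutes {..<d}" for f \<sigma>
    using that permutes_not_in[OF that(2)] by (auto simp: PiE_iff extensional_def)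
  fix f assume f: "f \<in> {..<d} \<rightarrow>\<^sub>E (UNIV :: 'n set)"
  show "f \<circ> \<tau> \<in> {..<d} \<rightarrow>\<^sub>E UNIV" "f \<circ> Hilbert_Choice.inv \<tau> \<in> {..<d} \<rightarrow>\<^sub>E UNIV"
    using PiE[OF f] \<tau> permutes_inv[OF \<tau>] by blast+
  show "f \<circ> \<tau> \<circ> Hilbert_Choice.inv \<tau> = f" "f \<circ> Hilbert_Choice.inv \<tau> \<circ> \<tau> = f"
    using permutes_inv_o[OF \<tau>] by (simp_all add: comp_assoc)
qed simp_all

text \<open>The weights do not change when two positions are exchanged, so the eigenvalue at position \<open>0\<close> can be
  replaced by the average over all positions.\<close>

lemma sum_first_eigenvalue_symmetrize:
  fixes l :: "'n::finite \<Rightarrow> real"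
  assumes "0 < d"
  shows "real d * (\<Sum>f\<in>{..<d} \<rightarrow>\<^sub>E UNIV. l (f 0) * det_weight d e w f)
    = (\<Sum>f\<in>{..<d} \<rightarrow>\<^sub>E UNIV. (\<Sum>i<d. l (f i)) * det_weight d e w f)"
proof -
  have eq: "(\<Sum>f\<in>{..<d} \<rightarrow>\<^sub>E UNIV. l (f i) * det_weight d e w f)
      = (\<Sum>f\<in>{..<d} \<rightarrow>\<^sub>E UNIV. l (f 0) * det_weight d e w f)" if "i < d" for i
  proof -
    have \<tau>: "Transposition.transpose 0 i permutes {..<d}" using assms that by (intro permutes_swap_id) auto
    show ?thesis
      using sum_PiE_permute[OF \<tau>, of "\<lambda>f. l (f 0) * det_weight d e w f"]
      unfolding det_weight_permute[OF \<tau>] comp_apply transpose_apply_first .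
  qed
  have "(\<Sum>i<d. \<Sum>f\<in>{..<d} \<rightarrow>\<^sub>E UNIV. l (f i) * det_weight d e w f)
      = (\<Sum>i<d. \<Sum>f\<in>{..<d} \<rightarrow>\<^sub>E UNIV. l (f 0) * det_weight d e w f)"
    by (rule sum.cong[OF refl], rule eq) simp
  then show ?thesis by (subst (asm) sum.swap) (simp add: sum_distrib_right)
qed

text \<open>After symmetrization the coefficient of a nonzero weight is the sum of the eigenvalues over a set of
  \<open>d\<close> indices. Frames of basis vectors single out one such set.\<close>

lemma first_eigenvalue_sum_nonneg_iff:
  fixes l :: "'n::finite \<Rightarrow> real" and e :: "'n \<Rightarrow> complex ^ 'n"
  assumes e: "\<And>p q. cinner (e p) (e q) = (if p = q then 1 else 0)" and d: "0 < d"
  shows "(\<forall>w. 0 \<le> (\<Sum>f\<in>{..<d} \<rightarrow>\<^sub>E UNIV. l (f 0) * det_weight d e w f))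
    \<longleftrightarrow> (\<forall>S. card S = d \<longrightarrow> 0 \<le> sum l S)" (is "(\<forall>w. 0 \<le> ?G w) \<longleftrightarrow> ?R")
proof -
  have G: "0 \<le> ?G w \<longleftrightarrow> 0 \<le> (\<Sum>f\<in>{..<d} \<rightarrow>\<^sub>E UNIV. (\<Sum>i<d. l (f i)) * det_weight d e w f)" for w
    unfolding sum_first_eigenvalue_symmetrize[OF d, symmetric] using d by (simp add: zero_le_mult_iff)
  have im: "(\<Sum>i<d. l (f i)) = sum l (f ` {..<d})" if "inj_on f {..<d}" for f
    using that by (simp add: sum.reindex)
  show ?thesis
  proof
    assume R: ?R
    have "0 \<le> (\<Sum>i<d. l (f i)) * det_weight d e w f" for f w
      using R det_weight_nonneg[of d e w f] det_weight_eq_0[of f d e w]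
      by (cases "inj_on f {..<d}") (auto simp: im card_image)
    then show "\<forall>w. 0 \<le> ?G w" unfolding G by (simp add: sum_nonneg)
  next
    assume L: "\<forall>w. 0 \<le> ?G w"
    show ?R
    proof (intro allI impI)
      fix S :: "'n set" assume S: "card S = d"
      obtain h where "bij_betw h {0..<card S} S" using ex_bij_betw_nat_finite[of S] by auto
      then have h: "bij_betw h {..<d} S" by (simp add: S atLeast0LessThan)
      define g where "g = restrict h {..<d}"
      have g: "inj_on g {..<d}" "g ` {..<d} = S" "g \<in> {..<d} \<rightarrow>\<^sub>E UNIV"
        using h by (auto simp: g_def bij_betw_def)
      let ?Z = "det_weight d e (\<lambda>a. e (g a))"
      have eq: "(\<Sum>i<d. l (f i)) * ?Z f = sum l S * ?Z f" for f
        using det_weight_dual_basis(2)[OF e g(1), of f] g(2) by (cases "?Z f = 0") (auto simp: im)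
      have "0 \<le> sum l S * (\<Sum>f\<in>{..<d} \<rightarrow>\<^sub>E UNIV. ?Z f)"
        using L[unfolded G, rule_format, of "\<lambda>a. e (g a)"] unfolding eq sum_distrib_left .
      moreover have "?Z g \<le> (\<Sum>f\<in>{..<d} \<rightarrow>\<^sub>E UNIV. ?Z f)"
        using g(3) by (intro member_le_sum) (auto simp: det_weight_nonneg finite_PiE)
      then have "0 < (\<Sum>f\<in>{..<d} \<rightarrow>\<^sub>E UNIV. ?Z f)"
        using det_weight_dual_basis(1)[OF e g(1)] by linarith
      ultimately show "0 \<le> sum l S" by (simp add: zero_le_mult_iff)
    qed
  qed
qed

lemma coeff_prod_linear:
  fixes l :: "'n \<Rightarrow> real"
  assumes "finite I"
  shows "coeff (\<Prod>p\<in>I. [:1, l p:]) j = (\<Sum>S | S \<subseteq> I \<and> card S = j. \<Prod>p\<in>S. l p)"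
proof -
  have "(\<Prod>p\<in>I. [:1, l p:]) = (\<Prod>p\<in>I. monom (l p) 1 + 1)"
    by (simp add: monom_Suc monom_0 one_pCons)
  also have "\<dots> = (\<Sum>S\<in>Pow I. \<Prod>p\<in>S. monom (l p) 1)"
    using prod_add[OF assms, of "\<lambda>p. monom (l p) 1" "\<lambda>_. 1"] by simp
  also have "\<dots> = (\<Sum>S\<in>Pow I. monom (\<Prod>p\<in>S. l p) (card S))"
  proof (rule sum.cong[OF refl])
    fix S assume "S \<in> Pow I"
    then have "finite S" using assms finite_subset by blast
    then show "(\<Prod>p\<in>S. monom (l p) 1) = monom (\<Prod>p\<in>S. l p) (card S)"
      by (induction S) (auto simp: mult_monom)
  qed
  finally have "coeff (\<Prod>p\<in>I. [:1, l p:]) j = (\<Sum>S\<in>Pow I. if card S = j then \<Prod>p\<in>S. l p else 0)"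
    by (simp add: coeff_sum)
  also have "\<dots> = (\<Sum>S\<in>Pow I \<inter> {S. card S = j}. \<Prod>p\<in>S. l p)"
    using assms by (subst sum.inter_restrict) auto
  also have "Pow I \<inter> {S. card S = j} = {S. S \<subseteq> I \<and> card S = j}" by auto
  finally show ?thesis .
qed

text \<open>The enumerations of the basis; in top degree these are the only choices with nonzero weight.\<close>

definition enumerations :: "(nat \<Rightarrow> 'n::finite) set" where
  "enumerations = {f \<in> {..<CARD('n)} \<rightarrow>\<^sub>E UNIV. inj_on f {..<CARD('n)}}"

lemma finite_enumerations: "finite (enumerations :: (nat \<Rightarrow> 'n::finite) set)"
  unfolding enumerations_def
  by (rule finite_subset[of _ "{..<CARD('n)} \<rightarrow>\<^sub>E UNIV"]) (auto intro: finite_PiE)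

lemma enumerations_bij:
  assumes "f \<in> (enumerations :: (nat \<Rightarrow> 'n::finite) set)"
  shows "bij_betw f {..<CARD('n)} UNIV"
proof -
  have inj: "inj_on f {..<CARD('n)}" using assms by (simp add: enumerations_def)
  then have "f ` {..<CARD('n)} = UNIV" by (intro card_subset_eq) (simp_all add: card_image)
  with inj show ?thesis by (simp add: bij_betw_def)
qed

lemma enumeration_extending:
  fixes S :: "'n::finite set"
  obtains f where "f \<in> enumerations" "f ` {..<card S} = S"
proof -
  obtain h where h: "bij_betw h {0..<card S} S" using ex_bij_betw_nat_finite[of S] by auto
  have le: "card S \<le> CARD('n)" by (intro card_mono) auto
  have "card {card S..<CARD('n)} = card (- S)" by (simp add: Compl_eq_Diff_UNIV card_Diff_subset)
  then obtain k where k: "bij_betw k {card S..<CARD('n)} (- S)"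
    using finite_same_card_bij[of "{card S..<CARD('n)}" "- S"] by auto
  define f where "f i = (if i < card S then h i else if i < CARD('n) then k i else undefined)" for i
  have "bij_betw f {0..<card S} S" "bij_betw f {card S..<CARD('n)} (- S)"
    using h k by (auto simp: f_def elim!: bij_betw_cong[THEN iffD1, rotated])
  from bij_betw_combine[OF this] have "bij_betw f ({0..<card S} \<union> {card S..<CARD('n)}) UNIV" by simp
  moreover have "{0..<card S} \<union> {card S..<CARD('n)} = {..<CARD('n)}" using le by auto
  ultimately have "f \<in> enumerations" using le by (auto simp: enumerations_def bij_betw_def f_def PiE_iff extensional_def)
  moreover have "f ` {..<card S} = S" using \<open>bij_betw f {0..<card S} S\<close> by (simp add: bij_betw_def atLeast0LessThan)
  ultimately show ?thesis using that by blast
qed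

text \<open>A permutation of the basis that maps \<open>S\<close> to \<open>S'\<close> maps the enumerations that begin with \<open>S\<close>
  injectively to those that begin with \<open>S'\<close>. So their number depends only on the size of \<open>S\<close>.\<close>

lemma card_enumerations_le:
  fixes S S' :: "'n::finite set"
  assumes "card S = card S'" and j: "j \<le> CARD('n)"
  shows "card {f \<in> enumerations. f ` {..<j} = S} \<le> card {f \<in> enumerations. f ` {..<j} = S'}"
proof -
  obtain a where a: "a \<in> (enumerations :: (nat \<Rightarrow> 'n) set)" "a ` {..<card S} = S" using enumeration_extending[of S] by blast
  obtain b where b: "b \<in> (enumerations :: (nat \<Rightarrow> 'n) set)" "b ` {..<card S'} = S'" using enumeration_extending[of S'] by blast
  define n where "n = CARD('n)"
  define p where "p = b \<circ> inv_into {..<n} a"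
  have p: "bij p" unfolding p_def n_def
    by (intro bij_betw_trans[OF bij_betw_inv_into[OF enumerations_bij[OF a(1)]]] enumerations_bij[OF b(1)])
  have "card S \<le> n" unfolding n_def by (intro card_mono) auto
  then have "inv_into {..<n} a ` S = {..<card S}"
    using bij_betw_imp_inj_on[OF enumerations_bij[OF a(1)]] unfolding n_def
    by (subst a(2)[symmetric]) (intro inv_into_image_cancel, auto)
  then have pS: "p ` S = S'" using assms b(2) by (simp only: p_def image_comp[symmetric])
  define \<Phi> where "\<Phi> f = restrict (p \<circ> f) {..<n}" for f :: "nat \<Rightarrow> 'n"
  show ?thesis
  proof (rule card_inj_on_le[of \<Phi>])
    show "inj_on \<Phi> {f \<in> enumerations. f ` {..<j} = S}"
    proof (rule inj_onI)
      fix f g assume f: "f \<in> {f \<in> enumerations. f ` {..<j} = S}" and g: "g \<in> {f \<in> enumerations. f ` {..<j} = S}" and eq: "\<Phi> f = \<Phi> g"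
      show "f = g"
      proof (rule PiE_ext[of _ "{..<n}" "\<lambda>_. UNIV"])
        show "f \<in> {..<n} \<rightarrow>\<^sub>E UNIV" "g \<in> {..<n} \<rightarrow>\<^sub>E UNIV" using f g by (auto simp: enumerations_def n_def)
        fix i assume "i \<in> {..<n}"
        then have "p (f i) = p (g i)" using fun_cong[OF eq, of i] by (simp add: \<Phi>_def)
        then show "f i = g i" using p by (auto simp: bij_def inj_def)
      qed
    qed
    show "\<Phi> ` {f \<in> enumerations. f ` {..<j} = S} \<subseteq> {f \<in> enumerations. f ` {..<j} = S'}"
    proof (clarsimp, intro conjI)
      fix f :: "nat \<Rightarrow> 'n" assume f: "f \<in> enumerations" "S = f ` {..<j}"
      have "inj_on (p \<circ> f) {..<n}"
        using f(1) p by (intro comp_inj_on) (auto simp: enumerations_def n_def bij_def intro: inj_on_subset)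
      then show "\<Phi> f \<in> enumerations" unfolding enumerations_def \<Phi>_def n_def[symmetric] by auto
      have "\<Phi> f ` {..<j} = (p \<circ> f) ` {..<j}"
        using j by (intro image_cong) (auto simp: \<Phi>_def n_def)
      then show "\<Phi> f ` {..<j} = S'" using pS f(2) by (simp add: image_comp)
    qed
  qed (simp add: finite_enumerations)
qed


text \<open>The constant is \<open>j! (n - j)!\<close>, the number of enumerations that begin with a given set of size \<open>j\<close>;
  only its sign and its independence of \<open>l\<close> are used.\<close>

lemma sum_enumerations:
  assumes j: "j \<le> CARD('n::finite)"
  obtains c :: real where "0 < c"
    "\<And>l :: 'n \<Rightarrow> real. (\<Sum>f\<in>enumerations. \<Prod>i<j. l (f i)) = c * coeff (\<Prod>p\<in>UNIV. [:1, l p:]) j"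
proof -
  obtain S0 :: "'n set" where S0: "card S0 = j"
    using obtain_subset_with_card_n[OF j] by auto
  define N where "N S = card {f \<in> enumerations. f ` {..<j} = S}" for S :: "'n set"
  have N: "N S = N S0" if "card S = j" for S
    unfolding N_def using that S0 j by (intro antisym card_enumerations_le) auto
  obtain f0 where "f0 \<in> enumerations" "f0 ` {..<card S0} = S0" using enumeration_extending by blast
  then have "0 < N S0"
    unfolding N_def using S0 finite_enumerations by (subst card_gt_0_iff) auto
  moreover have "(\<Sum>f\<in>enumerations. \<Prod>i<j. l (f i)) = real (N S0) * coeff (\<Prod>p\<in>UNIV. [:1, l p:]) j"
    for l :: "'n \<Rightarrow> real"
  proof -
    have inj: "inj_on f {..<j}" if "f \<in> enumerations" for f :: "nat \<Rightarrow> 'n"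
      using that j by (auto simp: enumerations_def intro: inj_on_subset)
    have "(\<Sum>f\<in>enumerations. \<Prod>i<j. l (f i))
        = (\<Sum>S | card S = j. \<Sum>f | f \<in> enumerations \<and> f ` {..<j} = S. \<Prod>i<j. l (f i))"
      by (rule sum.group[symmetric]) (auto simp: finite_enumerations inj card_image)
    also have "\<dots> = (\<Sum>S | card S = j. \<Sum>f | f \<in> enumerations \<and> f ` {..<j} = S. \<Prod>p\<in>S. l p)"
    proof (intro sum.cong[OF refl])
      fix S :: "'n set" and f assume "f \<in> {f \<in> enumerations. f ` {..<j} = S}"
      then have "f \<in> enumerations" "S = f ` {..<j}" by auto
      then show "(\<Prod>i<j. l (f i)) = (\<Prod>p\<in>S. l p)" by (simp add: prod.reindex inj)
    qed
    also have "\<dots> = (\<Sum>S | card S = j. real (N S0) * (\<Prod>p\<in>S. l p))"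
    proof (rule sum.cong[OF refl])
      fix S :: "'n set" assume "S \<in> {S. card S = j}"
      then have "N S = N S0" using N by simp
      moreover have "(\<Sum>f | f \<in> enumerations \<and> f ` {..<j} = S. \<Prod>p\<in>S. l p) = real (N S) * (\<Prod>p\<in>S. l p)"
        by (simp add: N_def)
      ultimately show "(\<Sum>f | f \<in> enumerations \<and> f ` {..<j} = S. \<Prod>p\<in>S. l p) = real (N S0) * (\<Prod>p\<in>S. l p)"
        by simp
    qed
    finally show ?thesis by (simp add: coeff_prod_linear sum_distrib_left)
  qed
  ultimately show ?thesis using that[of "real (N S0)"] by simp
qed

text \<open>Two enumerations differ by a permutation of the positions.\<close>

lemma det_weight_enumeration:
  assumes f: "f \<in> (enumerations :: (nat \<Rightarrow> 'n::finite) set)" and g: "g \<in> enumerations"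
  shows "det_weight CARD('n) e w f = det_weight CARD('n) e w g"
proof -
  define n where "n = CARD('n)"
  define \<tau> where "\<tau> i = (if i < n then inv_into {..<n} g (f i) else i)" for i
  have "bij_betw (inv_into {..<n} g \<circ> f) {..<n} {..<n}"
    unfolding n_def by (rule bij_betw_trans[OF enumerations_bij[OF f] bij_betw_inv_into[OF enumerations_bij[OF g]]])
  then have "bij_betw \<tau> {..<n} {..<n}" by (rule bij_betw_cong[THEN iffD1, rotated]) (simp add: \<tau>_def)
  then have \<tau>: "\<tau> permutes {..<n}" by (rule bij_imp_permutes) (simp add: \<tau>_def)
  have gi: "g (\<tau> i) = f i" if "i < n" for i
    using that bij_betw_imp_surj_on[OF enumerations_bij[OF g]]
    by (simp add: \<tau>_def n_def f_inv_into_f)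
  have "det_weight n e w f = det_weight n e w (g \<circ> \<tau>)"
    unfolding det_weight_def
    by (rule arg_cong[where f = "\<lambda>z. (cmod z)\<^sup>2"], rule leibniz_det_cong) (simp add: gi)
  then show ?thesis using det_weight_permute[OF \<tau>] by (simp add: n_def)
qed

lemma elementary_symmetric_sum_nonneg_iff:
  fixes l :: "'n::finite \<Rightarrow> real" and e :: "'n \<Rightarrow> complex ^ 'n"
  assumes e: "\<And>p q. cinner (e p) (e q) = (if p = q then 1 else 0)" and j: "j \<le> CARD('n)"
  shows "(\<forall>w. 0 \<le> (\<Sum>f\<in>{..<CARD('n)} \<rightarrow>\<^sub>E UNIV. (\<Prod>i<j. l (f i)) * det_weight CARD('n) e w f))
    \<longleftrightarrow> 0 \<le> coeff (\<Prod>p\<in>UNIV. [:1, l p:]) j"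
proof -
  obtain c :: real where c: "0 < c"
    "\<And>l :: 'n \<Rightarrow> real. (\<Sum>f\<in>enumerations. \<Prod>i<j. l (f i)) = c * coeff (\<Prod>p\<in>UNIV. [:1, l p:]) j"
    by (rule sum_enumerations[OF j], rule that; blast)
  obtain g where g: "g \<in> (enumerations :: (nat \<Rightarrow> 'n) set)" using enumeration_extending by blast
  have G: "(\<Sum>f\<in>{..<CARD('n)} \<rightarrow>\<^sub>E UNIV. (\<Prod>i<j. l (f i)) * det_weight CARD('n) e w f)
      = c * det_weight CARD('n) e w g * coeff (\<Prod>p\<in>UNIV. [:1, l p:]) j" for w
  proof -
    have "(\<Sum>f\<in>{..<CARD('n)} \<rightarrow>\<^sub>E UNIV. (\<Prod>i<j. l (f i)) * det_weight CARD('n) e w f)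
      = (\<Sum>f\<in>enumerations. (\<Prod>i<j. l (f i)) * det_weight CARD('n) e w f)"
      by (rule sum.mono_neutral_right) (auto simp: enumerations_def finite_PiE det_weight_eq_0)
    also have "\<dots> = (\<Sum>f\<in>enumerations. (\<Prod>i<j. l (f i)) * det_weight CARD('n) e w g)"
      by (intro sum.cong[OF refl] arg_cong2[where f = "(*)"] refl det_weight_enumeration g)
    finally show ?thesis unfolding sum_distrib_right[symmetric] c(2) by (simp only: mult_ac)
  qed
  have "inj_on g {..<CARD('n)}" using g by (simp add: enumerations_def)
  then have "det_weight CARD('n) e (\<lambda>a. e (g a)) g = 1" by (rule det_weight_dual_basis(1)[OF e])
  moreover have "0 \<le> c * det_weight CARD('n) e w g" for w
    using c(1) det_weight_nonneg[of "CARD('n)" e w g] by simp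
  ultimately show ?thesis
    unfolding G using c(1)
    by (metis mult_nonneg_nonneg mult.right_neutral zero_le_mult_iff not_less)
qed

text \<open>The numbers \<open>l p\<close> are the eigenvalues of the complex Hessian at \<open>z\<close>, and the coefficients are their
  elementary symmetric polynomials.\<close>

lemma eigenvalue_criteria:
  fixes u :: "complex ^ 'n::finite \<Rightarrow> real"
  assumes "C2_on \<Omega> u" "open \<Omega>" "z \<in> \<Omega>"
  obtains l :: "'n \<Rightarrow> real"
  where "\<And>j. j \<le> CARD('n) \<Longrightarrow> positive_form CARD('n) (hessian_form j (CARD('n) - j) u z)
      \<longleftrightarrow> 0 \<le> coeff (\<Prod>p\<in>UNIV. [:1, l p:]) j"
    and "\<And>k. 1 \<le> k \<Longrightarrow> positive_form k (hessian_form 1 (k - 1) u z)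
      \<longleftrightarrow> (\<forall>S. card S = k \<longrightarrow> 0 \<le> sum l S)"
proof -
  obtain e :: "'n \<Rightarrow> complex ^ 'n" and l :: "'n \<Rightarrow> real"
    where e: "\<And>p q. cinner (e p) (e q) = (if p = q then 1 else 0)"
      and parseval: "\<And>x y. cinner x y = (\<Sum>p\<in>UNIV. cinner x (e p) * cnj (cinner y (e p)))"
      and diag: "\<And>x y. (\<Sum>p\<in>UNIV. \<Sum>q\<in>UNIV. complex_hessian u z $ p $ q * (x $ p * cnj (y $ q)))
        = (\<Sum>p\<in>UNIV. of_real (l p) * (cinner x (e p) * cnj (cinner y (e p))))"
  proof (rule hermitian_diagonalization[of "complex_hessian u z"])
    show "complex_hessian u z $ q $ p = cnj (complex_hessian u z $ p $ q)" for p q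
      by (rule complex_hessian_hermitian[OF assms])
    fix e :: "'n \<Rightarrow> complex ^ 'n" and l :: "'n \<Rightarrow> real"
    assume "\<And>p q. cinner (e p) (e q) = (if p = q then 1 else 0)"
      "\<And>x y. cinner x y = (\<Sum>p\<in>UNIV. cinner x (e p) * cnj (cinner y (e p)))"
      "\<And>x y. (\<Sum>p\<in>UNIV. \<Sum>q\<in>UNIV. complex_hessian u z $ p $ q * (x $ p * cnj (y $ q)))
        = (\<Sum>p\<in>UNIV. of_real (l p) * (cinner x (e p) * cnj (cinner y (e p))))"
    then show thesis by (rule that)
  qed
  have two: "0 \<le> (2 :: real) ^ d * x \<longleftrightarrow> 0 \<le> x" for d :: nat and x
    using mult_le_cancel_left_pos[of "2 ^ d" 0 x] by simp
  have pos: "positive_form d (hessian_form j m u z) \<longleftrightarrow>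
      (\<forall>w. 0 \<le> (\<Sum>f\<in>{..<d} \<rightarrow>\<^sub>E UNIV. (\<Prod>i<j. l (f i)) * det_weight d e w f))" if "j + m = d" for d j m
    unfolding positive_form_def hessian_form_frame[OF parseval diag] that nonneg_Reals_of_real_iff two ..
  show ?thesis
  proof (rule that)
    fix j assume "j \<le> CARD('n)"
    then show "positive_form CARD('n) (hessian_form j (CARD('n) - j) u z)
      \<longleftrightarrow> 0 \<le> coeff (\<Prod>p\<in>UNIV. [:1, l p:]) j"
      using pos[of j "CARD('n) - j" "CARD('n)"] elementary_symmetric_sum_nonneg_iff[OF e] by simp
  next
    fix k :: nat assume "1 \<le> k"
    then show "positive_form k (hessian_form 1 (k - 1) u z) \<longleftrightarrow> (\<forall>S. card S = k \<longrightarrow> 0 \<le> sum l S)"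
      using pos[of 1 "k - 1" k] first_eigenvalue_sum_nonneg_iff[OF e, of k l] by simp
  qed
qed


section \<open>The characterization of (n-k+1)-subharmonicity\<close>

theorem theorem2p1:
  fixes u :: "complex ^ 'n::finite \<Rightarrow> real" and \<Omega> :: "(complex ^ 'n) set" and k :: nat
  assumes "CARD('n) \<le> 7"
    and "1 \<le> k" and "k \<le> CARD('n)"
    and "open \<Omega>" and "connected \<Omega>" and "\<Omega> \<noteq> {}"
    and "C2_on \<Omega> u"
  shows "m_subharmonic_on (CARD('n) - k + 1) \<Omega> u \<longleftrightarrow>
    (\<forall>z\<in>\<Omega>. positive_form k (hessian_form 1 (k - 1) u z) \<and>
            positive_form CARD('n) (hessian_form (CARD('n) - k + 1) (k - 1) u z))"
proof -
  define m where "m = CARD('n) - k + 1"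
  have m: "1 \<le> m" "m \<le> CARD('n)" "CARD('n) - m = k - 1" "k + m = CARD('n) + 1"
    using assms(2,3) by (auto simp: m_def)
  have "(\<forall>j\<in>{1..m}. positive_form CARD('n) (hessian_form j (CARD('n) - j) u z)) \<longleftrightarrow>
      positive_form k (hessian_form 1 (k - 1) u z) \<and> positive_form CARD('n) (hessian_form m (k - 1) u z)"
    if z: "z \<in> \<Omega>" for z
  proof -
    obtain l :: "'n \<Rightarrow> real"
      where \<sigma>: "\<And>j. j \<le> CARD('n) \<Longrightarrow> positive_form CARD('n) (hessian_form j (CARD('n) - j) u z)
        \<longleftrightarrow> 0 \<le> coeff (\<Prod>p\<in>UNIV. [:1, l p:]) j"
      and sums: "\<And>k. 1 \<le> k \<Longrightarrow> positive_form k (hessian_form 1 (k - 1) u z)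
        \<longleftrightarrow> (\<forall>S. card S = k \<longrightarrow> 0 \<le> sum l S)"
      by (rule eigenvalue_criteria[OF assms(7,4) z], rule that; blast)
    let ?E = "\<Prod>p\<in>UNIV. [:1, l p:]"
    have E0: "coeff ?E 0 = 1"
      by (simp add: coeff_prod_linear card_eq_0_iff)
    have "(\<forall>j\<in>{1..m}. positive_form CARD('n) (hessian_form j (CARD('n) - j) u z)) \<longleftrightarrow> nonneg_coeffs m ?E"
    proof -
      have "0 \<le> coeff ?E j" if "\<forall>j\<in>{1..m}. 0 \<le> coeff ?E j" "j \<le> m" for j
        using that E0 by (cases "j = 0") auto
      then show ?thesis using \<sigma> m(2) by (auto simp: nonneg_coeffs_def)
    qed
    also have "\<dots> \<longleftrightarrow> (\<forall>S. card S = k \<longrightarrow> 0 \<le> sum l S) \<and> 0 \<le> coeff ?E m"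
    proof
      assume nn: "nonneg_coeffs m ?E"
      then show "(\<forall>S. card S = k \<longrightarrow> 0 \<le> sum l S) \<and> 0 \<le> coeff ?E m"
        using subset_sums_nonneg[OF finite nn] m by (auto simp: nonneg_coeffs_def)
    next
      assume "(\<forall>S. card S = k \<longrightarrow> 0 \<le> sum l S) \<and> 0 \<le> coeff ?E m"
      then show "nonneg_coeffs m ?E"
        using nonneg_coeffs_of_subset_sums[of "UNIV :: 'n set" k l] assms(1-3) by (simp add: m_def)
    qed
    also have "\<dots> \<longleftrightarrow> positive_form k (hessian_form 1 (k - 1) u z) \<and> positive_form CARD('n) (hessian_form m (k - 1) u z)"
      using \<sigma>[OF m(2)] sums[OF assms(2)] m(3) by simp
    finally show ?thesis .
  qed
  then show ?thesis using assms(7) unfolding m_subharmonic_on_def m_def[symmetric] by blast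
qed

end
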